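(* Let $f^*\in C^0$ be a fixed point of the operator $\mathcal G$, and let $\delta>0$. Assume: [K1] for $i=1,2$, $\sup_{y\in[-1,1]}\int_{-1}^1|k_i(x,y)|\,dx<\infty$ and $\lim_{y\to\tilde y}\int_{-1}^1|k_i(x,y)-k_i(x,\tilde y)|\,dx=0$ for every $\tilde y\in[-1,1]$; [H1] $h:[-1,1]\times\mathbb R\to\mathbb R$ is continuous; [G1] $g$ is continuous on $[-1,1]$; [H2], [H3] in the ball $B(f^*,\delta)$: the partial derivatives $h_v=\partial h/\partial v$ and $h_{vv}=\partial^2h/\partial v^2$ exist and are continuous for $x\in[-1,1]$ and $|v-f^*(x)|\le\delta$. Moreover, assume that $1$ is not an eigenvalue of $\mathcal G'f^*$. Then there exist $\epsilon$ with $0<\epsilon\le\delta$ and $m_0\in\mathbb N$ such that, for every $m\ge m_0$, the operator $\mathcal G_m$ has a unique fixed point $f_m$ in $B(f^*,\epsilon)$.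
   Context: $C^0=C^0([-1,1])$ is the Banach space of real continuous functions on $[-1,1]$ with the maximum norm $\|\cdot\|_\infty$, and $B(f^*,\delta)=\{f\in C^0:\|f-f^*\|_\infty\le\delta\}$. The kernels $k_1,k_2$ are continuous on $[-1,1]^2$ (standing assumption). For $y\in[-1,1]$, $$(\mathcal Gf)(y)=\int_{-1}^1k_1(x,y)f(x)\,dx+\int_{-1}^1k_2(x,y)h(x,f(x))\,dx+g(y),$$ $$[(\mathcal G'f)\phi](y)=\int_{-1}^1k_1(x,y)\phi(x)\,dx+\int_{-1}^1k_2(x,y)h_v(x,f(x))\phi(x)\,dx,\qquad\phi\in C^0,$$ where $\mathcal G'f$ is the Fréchet derivative of $\mathcal G$ at $f$, and $$(\mathcal G_mf)(y)=\sum_{k=1}^m\lambda_kk_1(x_k,y)f(x_k)+\sum_{k=1}^m\lambda_kk_2(x_k,y)h(x_k,f(x_k))+g(y),$$ where $x_k$ and $\lambda_k$, $k=1,\dots,m$, are the nodes (zeros of the Legendre polynomial of degree $m$) and weights (Christoffel numbers) of the $m$-point Gauss–Legendre rule on $[-1,1]$. *)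

theory Defs
  imports "HOL-Analysis.Analysis" "HOL-Computational_Algebra.Polynomial"
begin

text \<open>
  The space \<open>C\<^sup>0([-1,1])\<close> with the metric of the maximum norm. Its points are functions
  \<^typ>\<open>real \<Rightarrow> real\<close> that are \<^const>\<open>undefined\<close> outside \<open>[-1,1]\<close>, so that equality in \<open>C\<^sup>0\<close> is
  equality of HOL functions. The ball \<open>B(f,\<delta>)\<close> is \<open>mcball_of C0 f \<delta>\<close>.
\<close>

definition C0 :: "(real \<Rightarrow> real) metric" where
  "C0 = cfunspace (top_of_set {-1..1}) euclidean_metric"

lemma mem_C0_iff:
  "f \<in> mspace C0 \<longleftrightarrow> f \<in> extensional {-1..1} \<and> continuous_on {-1..1} f"
proof -
  have "bounded (f ` {-1..1})" if "continuous_on {-1..1} f"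
    using that by (intro compact_imp_bounded compact_continuous_image) auto
  moreover have "Metric_space.mbounded UNIV dist S \<longleftrightarrow> bounded S" for S :: "real set"
    by simp
  ultimately show ?thesis
    by (auto simp: C0_def Metric_space.fspace_def[OF Met_TC.Metric_space_axioms])
qed

lemma mdist_C0:
  assumes "f \<in> mspace C0" "g \<in> mspace C0"
  shows "mdist C0 f g = (SUP x\<in>{-1..1}. \<bar>f x - g x\<bar>)"
proof -
  have "mdist C0 f g = Metric_space.fdist UNIV dist {-1..1} f g"
    by (simp add: C0_def cfunspace_def)
  moreover have "f \<in> Metric_space.fspace UNIV dist {-1..1}" "g \<in> Metric_space.fspace UNIV dist {-1..1}"
    using assms
    by (auto simp: C0_def Metric_space.fspace_def[OF Met_TC.Metric_space_axioms])
  ultimately show ?thesis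
    by (simp add: Metric_space.fdist_def[OF Met_TC.Metric_space_axioms] dist_real_def)
qed

definition is_eigenvalue_C0 :: "((real \<Rightarrow> real) \<Rightarrow> real \<Rightarrow> real) \<Rightarrow> real \<Rightarrow> bool" where
  "is_eigenvalue_C0 T \<mu> \<longleftrightarrow>
     (\<exists>\<phi>\<in>mspace C0. \<phi> \<noteq> (\<lambda>x\<in>{-1..1}. 0) \<and> T \<phi> = (\<lambda>x\<in>{-1..1}. \<mu> * \<phi> x))"

definition G_op ::
  "(real \<Rightarrow> real \<Rightarrow> real) \<Rightarrow> (real \<Rightarrow> real \<Rightarrow> real) \<Rightarrow> (real \<Rightarrow> real \<Rightarrow> real) \<Rightarrow> (real \<Rightarrow> real)
    \<Rightarrow> (real \<Rightarrow> real) \<Rightarrow> real \<Rightarrow> real" where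
  "G_op k1 k2 h g f = (\<lambda>y\<in>{-1..1}.
     integral {-1..1} (\<lambda>x. k1 x y * f x)
   + integral {-1..1} (\<lambda>x. k2 x y * h x (f x)) + g y)"

text \<open>The Frechet derivative of \<^const>\<open>G_op\<close> at \<open>f\<close>, applied to \<open>\<phi>\<close>; \<open>hv\<close> is \<open>\<partial>h/\<partial>v\<close>.\<close>

definition G_deriv ::
  "(real \<Rightarrow> real \<Rightarrow> real) \<Rightarrow> (real \<Rightarrow> real \<Rightarrow> real) \<Rightarrow> (real \<Rightarrow> real \<Rightarrow> real)
    \<Rightarrow> (real \<Rightarrow> real) \<Rightarrow> (real \<Rightarrow> real) \<Rightarrow> real \<Rightarrow> real" where
  "G_deriv k1 k2 hv f \<phi> = (\<lambda>y\<in>{-1..1}.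
     integral {-1..1} (\<lambda>x. k1 x y * \<phi> x)
   + integral {-1..1} (\<lambda>x. k2 x y * hv x (f x) * \<phi> x))"

text \<open>Rodrigues' formula.\<close>

definition legendre_poly :: "nat \<Rightarrow> real poly" where
  "legendre_poly m = smult (1 / (2 ^ m * fact m)) ((pderiv ^^ m) ([:-1, 0, 1:] ^ m))"

definition gauss_nodes :: "nat \<Rightarrow> real set" where
  "gauss_nodes m = {x. poly (legendre_poly m) x = 0}"

text \<open>
  The Christoffel number belonging to the node \<open>t\<close>: the integral of the fundamental Lagrange
  polynomial that is 1 at \<open>t\<close> and 0 at the other nodes.
\<close>

definition gauss_weight :: "nat \<Rightarrow> real \<Rightarrow> real" where
  "gauss_weight m t =
     integral {-1..1} (\<lambda>x. \<Prod>s\<in>gauss_nodes m - {t}. (x - s) / (t - s))"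

text \<open>Sums over \<open>k = 1, \<dots>, m\<close> become sums over the set of nodes, each with its own weight.\<close>

definition Gm_op ::
  "(real \<Rightarrow> real \<Rightarrow> real) \<Rightarrow> (real \<Rightarrow> real \<Rightarrow> real) \<Rightarrow> (real \<Rightarrow> real \<Rightarrow> real) \<Rightarrow> (real \<Rightarrow> real)
    \<Rightarrow> nat \<Rightarrow> (real \<Rightarrow> real) \<Rightarrow> real \<Rightarrow> real" where
  "Gm_op k1 k2 h g m f = (\<lambda>y\<in>{-1..1}.
     (\<Sum>t\<in>gauss_nodes m. gauss_weight m t * k1 t y * f t)
   + (\<Sum>t\<in>gauss_nodes m. gauss_weight m t * k2 t y * h t (f t)) + g y)"

end

theory Submission
  imports Defs "HOL-Complex_Analysis.Great_Picard"
begin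

text \<open>
  Write \<open>K\<close> for the Frechet derivative of the integral operator at the fixed point \<open>f\<^sup>*\<close> and \<open>K\<^sub>m\<close>
  for its Gauss discretization: both have the same continuous kernel
  \<open>a(x,y) = k\<^sub>1(x,y) + k\<^sub>2(x,y) h\<^sub>v(x,f\<^sup>*(x))\<close>, the integral over \<open>x\<close> being replaced by the
  quadrature sum. If \<open>I - K\<^sub>m\<close> is invertible, the fixed points of \<open>G\<^sub>m\<close> are those of the Newton-like map
  \<open>T f = (I - K\<^sub>m)\<^sup>-\<^sup>1 (G\<^sub>m f - K\<^sub>m f)\<close>. The theorem holds because \<open>T\<close> is a contraction with
  constant \<open>1/2\<close> on a small ball around \<open>f\<^sup>*\<close> whose radius does not depend on \<open>m\<close>. Three facts give this.

  Convergence of the rule. The Legendre polynomial of degree \<open>m\<close> has \<open>m\<close> distinct zeros in the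
  interval and is orthogonal to all polynomials of lower degree, so the rule is exact up to degree
  \<open>2m - 1\<close>; exactness on the squares of the Lagrange polynomials makes the weights nonnegative.
  Nonnegative weights of total mass \<open>2\<close> bound the rule by the maximum norm uniformly in \<open>m\<close>, and
  Weierstrass approximation then gives convergence for every continuous integrand
  (\<open>gauss_quad_tendsto_integral\<close>). For a continuous kernel the convergence is uniform in the
  parameter \<open>y\<close>, so \<open>G\<^sub>m f\<^sup>* - f\<^sup>*\<close> tends to 0.

  Stability. The operators \<open>K\<^sub>m\<close> need not converge to \<open>K\<close> in norm, but they are collectively
  compact: the images of the unit ball under all of them are jointly equicontinuous. If the inverses
  of \<open>I - K\<^sub>m\<close> were not bounded uniformly for large \<open>m\<close>, the theorem of Arzela and Ascoli would
  produce a limit \<open>\<psi>\<close> of norm 1 with \<open>\<psi> = K \<psi>\<close>, against the assumption on the eigenvalue 1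
  (\<open>gauss_quad_stability\<close>). Solvability of \<open>\<phi> - K\<^sub>m \<phi> = r\<close> is a square linear system for the
  values at the nodes, hence follows from uniqueness (\<open>gauss_quad_equation_solvable\<close>).

  Linearization. In the tube of radius \<open>\<epsilon>\<close> around the graph of \<open>f\<^sup>*\<close>, \<open>h\<^sub>v(x,v)\<close> differs from
  \<open>h\<^sub>v(x,f\<^sup>*(x))\<close> by at most a given \<open>\<eta>\<close> once \<open>\<epsilon>\<close> is small, by uniform continuity. By the mean value
  theorem \<open>G\<^sub>m - K\<^sub>m\<close> then has a Lipschitz constant of order \<open>\<eta>\<close> on the ball of radius \<open>\<epsilon>\<close>.
  With the stability bound this makes \<open>T\<close> a contraction, and the convergence of \<open>G\<^sub>m f\<^sup>* - f\<^sup>*\<close> to 0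
  keeps \<open>T f\<^sup>*\<close> so close to \<open>f\<^sup>*\<close> that \<open>T\<close> maps the ball into itself.
\<close>

section \<open>Zeros and orthogonality of derivatives of powers\<close>

text \<open>
  Each differentiation removes at most one factor \<open>w\<close>; hence the zeros of \<open>w\<close> remain zeros of all
  derivatives of \<open>w ^ m\<close> of order less than \<open>m\<close>. These are the boundary values needed both in the
  integration by parts and in the Rolle argument below.
\<close>

lemma higher_pderiv_power_dvd:
  fixes w :: "'a::idom poly"
  assumes "k \<le> m"
  shows "w ^ (m - k) dvd (pderiv ^^ k) (w ^ m)"
  using assms
proof (induction k)
  case (Suc k)
  obtain j where j: "m - k = Suc j" "m - Suc k = j"
    using Suc.prems by (metis Suc_diff_Suc Suc_le_lessD diff_Suc_Suc diff_diff_cancel)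
  obtain q where q: "(pderiv ^^ k) (w ^ m) = w ^ Suc j * q"
    using Suc j by (auto elim!: dvdE)
  have "(pderiv ^^ Suc k) (w ^ m) = w ^ j * (w * pderiv q + smult (of_nat (Suc j)) (pderiv w * q))"
    by (simp add: q pderiv_mult pderiv_power_Suc algebra_simps del: power_Suc) (simp add: algebra_simps)
  then show ?case by (simp add: j)
qed simp

text \<open>
  Integration by parts moves all \<open>n\<close> derivatives from \<open>u\<close> to \<open>q\<close>, where they give 0; the boundary
  terms vanish by assumption. The condition on \<open>q\<close> is on its \<open>n\<close>-th derivative rather than on its degree,
  since this form passes from \<open>q\<close> to \<open>pderiv q\<close> in the induction.
\<close>

lemma integral_poly_mult_higher_pderiv_eq_0:
  fixes u q :: "real poly"
  assumes boundary: "\<And>k. k < n \<Longrightarrow> poly ((pderiv ^^ k) u) a = 0 \<and> poly ((pderiv ^^ k) u) b = 0"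
    and ab: "a \<le> b" and q: "(pderiv ^^ n) q = 0"
  shows "integral {a..b} (\<lambda>x. poly q x * poly ((pderiv ^^ n) u) x) = 0"
  using boundary q
proof (induction n arbitrary: q)
  case (Suc n)
  let ?v = "(pderiv ^^ n) u"
  have int: "(\<lambda>x. poly p x * poly p' x) integrable_on {a..b}" for p p' :: "real poly"
    by (intro integrable_continuous_interval continuous_intros)
  have "((\<lambda>x. poly (pderiv (q * ?v)) x) has_integral poly (q * ?v) b - poly (q * ?v) a) {a..b}"
    using ab
    by (rule fundamental_theorem_of_calculus)
       (metis has_field_derivative_at_within has_real_derivative_iff_has_vector_derivative poly_DERIV)
  moreover have "poly ?v a = 0" "poly ?v b = 0"
    using Suc.prems(1)[of n] by auto
  ultimately have "integral {a..b} (\<lambda>x. poly (pderiv (q * ?v)) x) = 0"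
    by (simp add: integral_unique)
  moreover have "poly (pderiv (q * ?v)) x
      = poly q x * poly ((pderiv ^^ Suc n) u) x + poly (pderiv q) x * poly ?v x" for x
    by (simp add: pderiv_mult)
  ultimately have "integral {a..b} (\<lambda>x. poly q x * poly ((pderiv ^^ Suc n) u) x)
      + integral {a..b} (\<lambda>x. poly (pderiv q) x * poly ?v x) = 0"
    using integral_add[OF int[of q "(pderiv ^^ Suc n) u"] int[of "pderiv q" ?v]] by simp
  moreover have "integral {a..b} (\<lambda>x. poly (pderiv q) x * poly ?v x) = 0"
    using Suc.prems by (intro Suc.IH) (auto simp: funpow_swap1)
  ultimately show ?case by simp
qed simp

lemma poly_Rolle_increasing:
  fixes p :: "real poly"
  assumes x: "strict_mono_on {..n} x" and roots: "\<And>i. i \<le> n \<Longrightarrow> poly p (x i) = 0"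
  obtains y where "\<And>i. i < n \<Longrightarrow> x i < y i \<and> y i < x (Suc i) \<and> poly (pderiv p) (y i) = 0"
proof -
  have "\<exists>y. x i < y \<and> y < x (Suc i) \<and> poly (pderiv p) y = 0" if "i < n" for i
  proof -
    have "x i < x (Suc i)" using x that by (auto simp: strict_mono_on_def)
    from poly_MVT[OF this, of p] roots[of i] roots[of "Suc i"] that this show ?thesis by auto
  qed
  then show thesis using that by metis
qed

text \<open>
  Rolle's theorem, applied \<open>k\<close> times. As long as \<open>k < m\<close>, the end points are zeros of the \<open>k\<close>-th
  derivative too, so the \<open>k + 2\<close> zeros \<open>a = x 0 < \<dots> < x (Suc k) = b\<close> yield \<open>k + 1\<close> inner zeros of the
  next derivative. The statement keeps the end points in the list but claims only the inner ones as zeros,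
  because for \<open>k = m\<close> the end points are in general no longer zeros.
\<close>

lemma higher_pderiv_power_roots:
  fixes w :: "real poly"
  assumes w: "poly w a = 0" "poly w b = 0" and ab: "a < b" and "k \<le> m"
  shows "\<exists>x. x 0 = a \<and> x (Suc k) = b \<and> strict_mono_on {..Suc k} x
           \<and> (\<forall>i\<in>{1..k}. poly ((pderiv ^^ k) (w ^ m)) (x i) = 0)"
  using \<open>k \<le> m\<close>
proof (induction k)
  case 0
  show ?case
    by (intro exI[of _ "\<lambda>i. if i = 0 then a else b"]) (use ab in \<open>auto simp: strict_mono_on_def\<close>)
next
  case (Suc k)
  let ?p = "(pderiv ^^ k) (w ^ m)"
  from Suc obtain x where x: "x 0 = a" "x (Suc k) = b" "strict_mono_on {..Suc k} x"
    and inner: "\<And>i. i \<in> {1..k} \<Longrightarrow> poly ?p (x i) = 0" by auto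
  have "w dvd ?p"
    using higher_pderiv_power_dvd[of k m w] dvd_power[of "m - k" w] Suc.prems
    by (meson Suc_le_lessD dvd_trans less_imp_le zero_less_diff)
  then have "poly ?p a = 0" "poly ?p b = 0" using w by (auto elim!: dvdE)
  then have "poly ?p (x i) = 0" if "i \<le> Suc k" for i
    using that x(1,2) inner[of i] by (cases "i = 0 \<or> i = Suc k") auto
  from poly_Rolle_increasing[OF x(3) this] obtain y
    where y: "\<And>i. i < Suc k \<Longrightarrow> x i < y i \<and> y i < x (Suc i) \<and> poly (pderiv ?p) (y i) = 0" by blast
  \<comment> \<open>The new list: the end points, with the Rolle zeros shifted by one index between them.\<close>
  define z where "z i = (if i = 0 then a else if i = Suc (Suc k) then b else y (i - 1))" for i
  have le: "x i \<le> x j" if "i \<le> j" "j \<le> Suc k" for i j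
    using x(3) that by (meson atMost_iff le_trans strict_mono_on_leD)
  have "strict_mono_on {..Suc (Suc k)} z"
  proof (rule strict_mono_onI)
    fix i j assume ij: "i \<in> {..Suc (Suc k)}" "j \<in> {..Suc (Suc k)}" "i < j"
    have l: "z i < x i" if "0 < i" "i \<le> Suc k" for i using y[of "i - 1"] that by (auto simp: z_def)
    have r: "x (i - 1) < z i" if "0 < i" "i \<le> Suc k" for i using y[of "i - 1"] that by (auto simp: z_def)
    consider "i = 0" "j = Suc (Suc k)" | "i = 0" "j \<le> Suc k" | "0 < i" "j = Suc (Suc k)" | "0 < i" "j \<le> Suc k"
      using ij by force
    then show "z i < z j"
    proof cases
      case 1 then show ?thesis using ab by (simp add: z_def)
    next
      case 2 then show ?thesis using r[of j] le[of 0 "j-1"] ij x by (force simp: z_def)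
    next
      case 3 then show ?thesis using l[of i] le[of i "Suc k"] ij x by (force simp: z_def)
    next
      case 4 then show ?thesis using l[of i] r[of j] le[of i "j-1"] ij by force
    qed
  qed
  moreover have "poly ((pderiv ^^ Suc k) (w ^ m)) (z i) = 0" if "i \<in> {1..Suc k}" for i
    using y[of "i - 1"] that by (auto simp: z_def)
  ultimately show ?case by (intro exI[of _ z]) (simp add: z_def[of 0] z_def[of "Suc (Suc k)"])
qed

section \<open>Legendre polynomials and the Gauss nodes\<close>

lemma degree_legendre_poly [simp]: "degree (legendre_poly m) = m"
proof -
  have "degree ([:-1, 0, 1::real:] ^ m) = 2 * m"
    by (simp add: degree_power_eq)
  then show ?thesis
    by (simp add: legendre_poly_def degree_higher_pderiv)
qed

lemma gauss_nodes_eq: "gauss_nodes m = {x. poly ((pderiv ^^ m) ([:-1, 0, 1:] ^ m)) x = 0}"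
  by (simp add: gauss_nodes_def legendre_poly_def)

text \<open>
  By Rolle there are at least \<open>m\<close> zeros strictly inside the interval, by the degree there are at
  most \<open>m\<close> zeros altogether; so all nodes lie in the interval.
\<close>

lemma
  assumes "m \<ge> 1"
  shows finite_gauss_nodes: "finite (gauss_nodes m)"
    and card_gauss_nodes: "card (gauss_nodes m) = m"
    and gauss_nodes_subset: "gauss_nodes m \<subseteq> {-1..1}"
proof -
  have nz: "legendre_poly m \<noteq> 0" using assms degree_legendre_poly[of m] by (metis degree_0 not_one_le_zero)
  then show fin: "finite (gauss_nodes m)" by (simp add: gauss_nodes_def poly_roots_finite)
  have upper: "card (gauss_nodes m) \<le> m"
    using card_poly_roots_bound[OF nz] by (simp add: gauss_nodes_def)
  obtain x where x: "x 0 = -1" "x (Suc m) = 1" "strict_mono_on {..Suc m} x"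
    and roots: "\<And>i. i \<in> {1..m} \<Longrightarrow> x i \<in> gauss_nodes m"
    using higher_pderiv_power_roots[of "[:-1, 0, 1:]" "-1" 1 m m] by (auto simp: gauss_nodes_eq)
  have inj: "inj_on x {1..m}"
    by (rule inj_on_subset[OF strict_mono_on_imp_inj_on[OF x(3)]]) auto
  have "x ` {1..m} = gauss_nodes m"
    using upper roots card_image[OF inj] by (intro card_seteq fin) auto
  moreover have "x i \<in> {-1..1}" if "i \<in> {1..m}" for i
    using that x(1,2) strict_mono_onD[OF x(3), of 0 i] strict_mono_onD[OF x(3), of i "Suc m"] by auto
  ultimately show "gauss_nodes m \<subseteq> {-1..1}" by (metis image_subsetI)
  show "card (gauss_nodes m) = m"
    using card_image[OF inj] \<open>x ` {1..m} = gauss_nodes m\<close> by simp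
qed

lemma legendre_poly_orthogonal:
  assumes "degree q < m"
  shows "integral {-1..1} (\<lambda>x. poly q x * poly (legendre_poly m) x) = 0"
proof -
  let ?w = "[:-1, 0, 1:] :: real poly"
  have q0: "(pderiv ^^ m) q = 0"
    by (intro poly_eqI) (use assms in \<open>simp add: coeff_higher_pderiv coeff_eq_0\<close>)
  have "poly ((pderiv ^^ k) (?w ^ m)) (-1) = 0 \<and> poly ((pderiv ^^ k) (?w ^ m)) 1 = 0" if "k < m" for k
  proof -
    have "?w dvd (pderiv ^^ k) (?w ^ m)"
      using higher_pderiv_power_dvd[of k m ?w] that
        dvd_power[of "m - k" ?w] by (meson dvd_trans less_imp_le zero_less_diff)
    then show ?thesis by (auto elim!: dvdE)
  qed
  from integral_poly_mult_higher_pderiv_eq_0[OF this _ q0]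
  have "integral {-1..1} (\<lambda>x. poly q x * poly ((pderiv ^^ m) (?w ^ m)) x) = 0" by simp
  moreover have "poly q x * poly (legendre_poly m) x
      = 1 / (2 ^ m * fact m) * (poly q x * poly ((pderiv ^^ m) (?w ^ m)) x)" for x
    by (simp add: legendre_poly_def)
  ultimately show ?thesis by (simp only: integral_mult_right mult_zero_right)
qed

section \<open>Gauss--Legendre quadrature\<close>

definition gauss_quad :: "nat \<Rightarrow> (real \<Rightarrow> real) \<Rightarrow> real" where
  "gauss_quad m F = (\<Sum>t\<in>gauss_nodes m. gauss_weight m t * F t)"

definition lagrange_basis :: "real set \<Rightarrow> real \<Rightarrow> real poly" where
  "lagrange_basis N t = (\<Prod>s\<in>N - {t}. smult (1 / (t - s)) [:- s, 1:])"

lemma poly_lagrange_basis: "poly (lagrange_basis N t) x = (\<Prod>s\<in>N - {t}. (x - s) / (t - s))"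
  by (simp add: lagrange_basis_def poly_prod diff_divide_distrib algebra_simps)

lemma poly_lagrange_basis_node:
  assumes "finite N" "s \<in> N" "t \<in> N"
  shows "poly (lagrange_basis N t) s = (if s = t then 1 else 0)"
proof (cases "s = t")
  case False
  then have "s \<in> N - {t}" using assms by auto
  then show ?thesis using False assms by (auto simp: poly_lagrange_basis intro!: prod_zero bexI[of _ s])
next
  case True
  have "(\<Prod>r\<in>N - {t}. (t - r) / (t - r)) = (\<Prod>r\<in>N - {t}. 1)" by (rule prod.cong) auto
  then show ?thesis using True by (simp add: poly_lagrange_basis)
qed

lemma degree_lagrange_basis:
  assumes "finite N" "t \<in> N"
  shows "degree (lagrange_basis N t) \<le> card N - 1"
proof -
  have "degree (lagrange_basis N t) \<le> (\<Sum>s\<in>N - {t}. 1)"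
    unfolding lagrange_basis_def by (intro order_trans[OF degree_prod_sum_le] sum_mono) (use assms in auto)
  then show ?thesis using assms by (simp add: card_Diff_singleton)
qed

lemma gauss_weight_eq: "gauss_weight m t = integral {-1..1} (poly (lagrange_basis (gauss_nodes m) t))"
  by (simp add: gauss_weight_def poly_lagrange_basis[abs_def])

lemma integrable_poly: "poly p integrable_on {a..b}" for p :: "real poly"
  by (intro integrable_continuous_interval continuous_intros)

text \<open>
  Gauss' argument: divide \<open>p\<close> by the Legendre polynomial. The quotient has degree less than \<open>m\<close>, so its
  multiple of the Legendre polynomial has integral 0 by orthogonality, and it contributes nothing to the sum
  because it vanishes at the nodes. The remainder is its own Lagrange interpolant, for which the rule
  is exact by the definition of the weights.
\<close>

lemma gauss_quad_exact:
  assumes m: "m \<ge> 1" and p: "degree p < 2 * m"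
  shows "gauss_quad m (poly p) = integral {-1..1} (poly p)"
proof -
  let ?N = "gauss_nodes m" and ?P = "legendre_poly m"
  note fin = finite_gauss_nodes[OF m]
  define q r where "q = p div ?P" and "r = p mod ?P"
  have pqr: "p = q * ?P + r" by (simp add: q_def r_def)
  have P0: "?P \<noteq> 0" using m degree_legendre_poly[of m] by (metis degree_0 not_one_le_zero)
  have r: "degree r < m" using degree_mod_less'[OF P0, of p] m unfolding r_def by (cases "p mod ?P = 0") auto
  have q: "degree q < m"
  proof (rule ccontr)
    assume q: "\<not> degree q < m"
    then have "degree (q * ?P) = degree q + m"
      using m P0 by (subst degree_mult_eq) auto
    moreover from this have "degree p = degree (q * ?P)"
      unfolding pqr using r q by (intro degree_add_eq_left) linarith
    ultimately show False using p q by linarith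
  qed
  have interp: "r = (\<Sum>t\<in>?N. smult (poly r t) (lagrange_basis ?N t))"
  proof (rule poly_eqI_degree[where A = ?N])
    show "card ?N > degree r" using r card_gauss_nodes[OF m] by simp
    have "degree (\<Sum>t\<in>?N. smult (poly r t) (lagrange_basis ?N t)) \<le> m - 1"
      using degree_lagrange_basis[OF fin] card_gauss_nodes[OF m]
      by (intro degree_sum_le fin) (auto intro: order_trans[OF degree_smult_le])
    then show "card ?N > degree (\<Sum>t\<in>?N. smult (poly r t) (lagrange_basis ?N t))"
      using m card_gauss_nodes[OF m] by linarith
    show "poly r x = poly (\<Sum>t\<in>?N. smult (poly r t) (lagrange_basis ?N t)) x" if "x \<in> ?N" for x
      using that fin by (simp add: poly_sum poly_lagrange_basis_node if_distrib sum.delta' cong: if_cong sum.cong)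
  qed
  have "poly p = (\<lambda>x. poly q x * poly ?P x + poly r x)" "poly (q * ?P) = (\<lambda>x. poly q x * poly ?P x)"
    by (subst pqr) (simp_all add: fun_eq_iff)
  then have "integral {-1..1} (poly p)
      = integral {-1..1} (\<lambda>x. poly q x * poly ?P x) + integral {-1..1} (poly r)"
    using integral_add[OF integrable_poly[of "q * ?P" "-1" 1] integrable_poly[of r "-1" 1]]
    by simp
  also have "\<dots> = integral {-1..1} (poly r)" using legendre_poly_orthogonal[OF q] by simp
  also have "\<dots> = integral {-1..1} (\<lambda>x. \<Sum>t\<in>?N. poly r t * poly (lagrange_basis ?N t) x)"
    by (subst interp) (simp add: poly_sum[abs_def])
  also have "\<dots> = (\<Sum>t\<in>?N. poly r t * gauss_weight m t)"
    by (subst integral_sum) (auto simp: fin gauss_weight_eq integrable_poly intro!: integrable_on_mult_right)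
  also have "\<dots> = gauss_quad m (poly p)"
    unfolding gauss_quad_def
  proof (rule sum.cong[OF refl])
    fix t assume "t \<in> ?N"
    then have "poly ?P t = 0" by (simp add: gauss_nodes_def)
    then have "poly p t = poly r t" by (subst pqr) simp
    then show "poly r t * gauss_weight m t = gauss_weight m t * poly p t" by simp
  qed
  finally show ?thesis by simp
qed

text \<open>
  The square of the Lagrange polynomial of the node \<open>t\<close> has degree \<open>2m - 2\<close>, so the rule integrates it
  exactly; the quadrature sum is the weight of \<open>t\<close>, the integral is nonnegative.
\<close>

lemma gauss_weight_nonneg:
  assumes m: "m \<ge> 1" and t: "t \<in> gauss_nodes m"
  shows "gauss_weight m t \<ge> 0"
proof -
  let ?N = "gauss_nodes m" and ?l = "lagrange_basis (gauss_nodes m) t"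
  note fin = finite_gauss_nodes[OF m]
  have "degree (?l * ?l) \<le> (m - 1) + (m - 1)"
    using degree_mult_le[of ?l ?l] degree_lagrange_basis[OF fin t] card_gauss_nodes[OF m] by linarith
  then have "degree (?l * ?l) < 2 * m" using m by linarith
  from gauss_quad_exact[OF m this, symmetric]
  have "integral {-1..1} (poly (?l * ?l)) = (\<Sum>s\<in>?N. gauss_weight m s * (if s = t then 1 else 0))"
    by (simp only:) (auto simp: gauss_quad_def poly_lagrange_basis_node fin t intro!: sum.cong)
  also have "\<dots> = gauss_weight m t" using fin t by (simp add: if_distrib cong: if_cong)
  finally have "gauss_weight m t = integral {-1..1} (poly (?l * ?l))" ..
  also have "\<dots> \<ge> 0" by (intro integral_nonneg integrable_poly) auto
  finally show ?thesis .
qed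

lemma sum_gauss_weight:
  assumes "m \<ge> 1"
  shows "(\<Sum>t\<in>gauss_nodes m. gauss_weight m t) = 2"
  using gauss_quad_exact[OF assms, of 1] assms integral_const_real[of 1 "-1" 1]
  by (simp add: gauss_quad_def poly_1[abs_def])

text \<open>
  Since the weights are nonnegative, their total mass \<open>2\<close> bounds the rule on the unit ball of the maximum
  norm independently of \<open>m\<close>. Every estimate below that is uniform in \<open>m\<close> rests on this.
\<close>

lemma gauss_quad_bound:
  assumes m: "m \<ge> 1" and F: "\<And>x. x \<in> {-1..1} \<Longrightarrow> \<bar>F x\<bar> \<le> B"
  shows "\<bar>gauss_quad m F\<bar> \<le> 2 * B"
proof -
  have "\<bar>gauss_quad m F\<bar> \<le> (\<Sum>t\<in>gauss_nodes m. \<bar>gauss_weight m t * F t\<bar>)"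
    unfolding gauss_quad_def by (rule sum_abs)
  also have "\<dots> \<le> (\<Sum>t\<in>gauss_nodes m. gauss_weight m t * B)"
    using gauss_weight_nonneg[OF m] gauss_nodes_subset[OF m] F
    by (intro sum_mono) (auto simp: abs_mult intro!: mult_mono)
  also have "\<dots> = 2 * B" using sum_gauss_weight[OF m] by (simp flip: sum_distrib_right)
  finally show ?thesis .
qed

lemma gauss_quad_diff: "gauss_quad m (\<lambda>x. F x - H x) = gauss_quad m F - gauss_quad m H"
  by (simp add: gauss_quad_def algebra_simps sum_subtractf)

text \<open>
  Weierstrass approximation reduces the claim to polynomials, on which the rule is eventually exact; the
  approximation error costs at most twice its maximum norm in the sum and in the integral alike.
\<close>

lemma gauss_quad_tendsto_integral:
  assumes F: "continuous_on {-1..1} F"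
  shows "(\<lambda>m. gauss_quad m F) \<longlonglongrightarrow> integral {-1..1} F"
proof (rule LIMSEQ_I)
  fix e :: real assume e: "e > 0"
  obtain f where f: "real_polynomial_function f" and close: "\<And>x. x \<in> {-1..1} \<Longrightarrow> \<bar>F x - f x\<bar> < e / 5"
    using Stone_Weierstrass_real_polynomial_function[OF compact_Icc F, of "e / 5"] e by auto
  obtain a n where fa: "f = (\<lambda>x. \<Sum>i\<le>n. a i * x ^ i)"
    using f by (auto simp: real_polynomial_function_iff_sum)
  define p where "p = (\<Sum>i\<le>n. monom (a i) i)"
  have fp: "f = poly p" by (simp add: fun_eq_iff fa p_def poly_sum poly_monom)
  have "norm (gauss_quad m F - integral {-1..1} F) < e" if "m \<ge> degree p + 1" for m
  proof -
    have m: "m \<ge> 1" "degree p < 2 * m" using that by auto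
    have "\<bar>gauss_quad m F - gauss_quad m (poly p)\<bar> \<le> 2 * (e / 5)"
      unfolding gauss_quad_diff[symmetric] using close fp by (intro gauss_quad_bound m) (force intro: less_imp_le)
    moreover have "norm (integral {-1..1} (\<lambda>x. F x - poly p x)) \<le> (e / 5) * (1 - (-1))"
      using close fp F
      by (intro integral_bound) (auto intro!: continuous_intros less_imp_le)
    then have "\<bar>integral {-1..1} F - integral {-1..1} (poly p)\<bar> \<le> 2 * (e / 5)"
      by (simp add: integral_diff[OF integrable_continuous_interval[OF F] integrable_poly])
    ultimately show ?thesis using gauss_quad_exact[OF m] e by (simp only: real_norm_def)
  qed
  then show "\<exists>N. \<forall>m\<ge>N. norm (gauss_quad m F - integral {-1..1} F) < e" by blast
qed

section \<open>Quadrature of continuous kernels\<close>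

lemma continuous_on_kernel_section:
  assumes "continuous_on (S \<times> T) (\<lambda>(x, y). k x y)"
  shows "x \<in> S \<Longrightarrow> continuous_on T (k x)"
    and "y \<in> T \<Longrightarrow> continuous_on S (\<lambda>x. k x y)"
proof -
  assume x: "x \<in> S"
  have "continuous_on T (\<lambda>y. (x, y))" by (intro continuous_intros)
  from continuous_on_compose2[OF assms this] x show "continuous_on T (k x)" by auto
next
  assume y: "y \<in> T"
  have "continuous_on S (\<lambda>x. (x, y))" by (intro continuous_intros)
  from continuous_on_compose2[OF assms this] y show "continuous_on S (\<lambda>x. k x y)" by auto
qed

lemma kernel_bounded:
  fixes k :: "real \<Rightarrow> real \<Rightarrow> real"
  assumes "continuous_on ({-1..1} \<times> {-1..1}) (\<lambda>(x, y). k x y)"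
  obtains B where "B > 0" "\<And>x y. x \<in> {-1..1} \<Longrightarrow> y \<in> {-1..1} \<Longrightarrow> \<bar>k x y\<bar> \<le> B"
proof -
  have "bounded ((\<lambda>(x, y). k x y) ` ({-1..1} \<times> {-1..1}))"
    by (intro compact_imp_bounded compact_continuous_image assms compact_Times compact_Icc)
  then obtain B where "B > 0" "\<forall>z\<in>(\<lambda>(x, y). k x y) ` ({-1..1} \<times> {-1..1}). norm z \<le> B"
    by (auto simp: bounded_pos)
  then show thesis using that[of B] by (metis SigmaI case_prod_conv imageI real_norm_def)
qed

lemma kernel_equicontinuous:
  fixes k :: "real \<Rightarrow> real \<Rightarrow> real"
  assumes k: "continuous_on ({-1..1} \<times> {-1..1}) (\<lambda>(x, y). k x y)" and "e > 0"
  obtains d where "d > 0"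
    "\<And>x y y'. \<lbrakk>x \<in> {-1..1}; y \<in> {-1..1}; y' \<in> {-1..1}; \<bar>y - y'\<bar> < d\<rbrakk> \<Longrightarrow> \<bar>k x y - k x y'\<bar> < e"
proof -
  have "uniformly_continuous_on ({-1..1} \<times> {-1..1}) (\<lambda>(x, y). k x y)"
    by (intro compact_uniformly_continuous k compact_Times compact_Icc)
  then obtain d where d: "d > 0" and dd: "\<And>p p'. \<lbrakk>p \<in> {-1..1} \<times> {-1..1}; p' \<in> {-1..1} \<times> {-1..1}; dist p' p < d\<rbrakk>
      \<Longrightarrow> dist ((\<lambda>(x, y). k x y) p') ((\<lambda>(x, y). k x y) p) < e"
    using \<open>e > 0\<close> unfolding uniformly_continuous_on_def by metis
  show thesis
  proof (rule that[OF d])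
    fix x y y' :: real assume "x \<in> {-1..1}" "y \<in> {-1..1}" "y' \<in> {-1..1}" "\<bar>y - y'\<bar> < d"
    then show "\<bar>k x y - k x y'\<bar> < e"
      using dd[of "(x, y')" "(x, y)"] by (simp add: dist_Pair_Pair dist_real_def)
  qed
qed

text \<open>
  Pointwise convergence on a finite net of parameters extends to all parameters, because the sections
  \<open>k(\<cdot>,y)\<close> depend uniformly continuously on \<open>y\<close> and the rules are uniformly bounded.
\<close>

lemma gauss_quad_tendsto_integral_uniformly:
  fixes k :: "real \<Rightarrow> real \<Rightarrow> real"
  assumes k: "continuous_on ({-1..1} \<times> {-1..1}) (\<lambda>(x, y). k x y)" and e: "e > 0"
  shows "\<forall>\<^sub>F m in sequentially. \<forall>y\<in>{-1..1}.
           \<bar>gauss_quad m (\<lambda>x. k x y) - integral {-1..1} (\<lambda>x. k x y)\<bar> < e"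
proof -
  obtain d where d: "d > 0"
    and near: "\<And>x y y'. \<lbrakk>x \<in> {-1..1}; y \<in> {-1..1}; y' \<in> {-1..1}; \<bar>y - y'\<bar> < d\<rbrakk> \<Longrightarrow> \<bar>k x y - k x y'\<bar> < e / 6"
    using kernel_equicontinuous[OF k, of "e / 6"] e by auto
  obtain Y :: "real set" where Y: "finite Y" "Y \<subseteq> {-1..1}" "{-1..1} \<subseteq> (\<Union>y\<in>Y. ball y d)"
    using seq_compact_imp_totally_bounded[of "{-1..1::real}"] d
    by (metis compact_Icc compact_imp_seq_compact)
  note sect = continuous_on_kernel_section(2)[OF k]
  have "\<forall>\<^sub>F m in sequentially. \<forall>y\<in>Y.
           \<bar>gauss_quad m (\<lambda>x. k x y) - integral {-1..1} (\<lambda>x. k x y)\<bar> < e / 3"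
  proof (rule eventually_ball_finite[OF Y(1)], rule ballI)
    fix y assume "y \<in> Y"
    then have "(\<lambda>m. gauss_quad m (\<lambda>x. k x y)) \<longlonglongrightarrow> integral {-1..1} (\<lambda>x. k x y)"
      using Y(2) by (intro gauss_quad_tendsto_integral sect) auto
    from tendstoD[OF this, of "e / 3"] e
    show "\<forall>\<^sub>F m in sequentially. \<bar>gauss_quad m (\<lambda>x. k x y) - integral {-1..1} (\<lambda>x. k x y)\<bar> < e / 3"
      by (simp add: dist_real_def)
  qed
  then show ?thesis
    using eventually_ge_at_top[of 1]
  proof eventually_elim
    fix m :: nat assume net: "\<forall>y\<in>Y. \<bar>gauss_quad m (\<lambda>x. k x y) - integral {-1..1} (\<lambda>x. k x y)\<bar> < e / 3"
      and m: "1 \<le> m"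
    show "\<forall>y\<in>{-1..1}. \<bar>gauss_quad m (\<lambda>x. k x y) - integral {-1..1} (\<lambda>x. k x y)\<bar> < e"
    proof
      fix y :: real assume y: "y \<in> {-1..1}"
      then obtain y' where y': "y' \<in> Y" "\<bar>y - y'\<bar> < d" using Y by (force simp: dist_real_def)
      then have y'I: "y' \<in> {-1..1}" using Y by auto
      have close: "\<bar>k x y - k x y'\<bar> \<le> e / 6" if "x \<in> {-1..1}" for x
        using near[OF that y y'I y'(2)] by simp
      have "\<bar>gauss_quad m (\<lambda>x. k x y) - gauss_quad m (\<lambda>x. k x y')\<bar> \<le> 2 * (e / 6)"
        unfolding gauss_quad_diff[symmetric] by (intro gauss_quad_bound m close)
      moreover have "norm (integral {-1..1} (\<lambda>x. k x y - k x y')) \<le> (e / 6) * (1 - (-1))"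
        by (intro integral_bound continuous_intros sect y y'I) (use close in auto)
      then have "\<bar>integral {-1..1} (\<lambda>x. k x y) - integral {-1..1} (\<lambda>x. k x y')\<bar> \<le> 2 * (e / 6)"
        by (simp add: integral_diff integrable_continuous_interval sect y y'I del: atLeastAtMost_iff)
      moreover have "\<bar>gauss_quad m (\<lambda>x. k x y') - integral {-1..1} (\<lambda>x. k x y')\<bar> < e / 3"
        using net y' by auto
      ultimately show "\<bar>gauss_quad m (\<lambda>x. k x y) - integral {-1..1} (\<lambda>x. k x y)\<bar> < e" by linarith
    qed
  qed
qed

lemma continuous_on_gauss_quad:
  assumes "m \<ge> 1" "\<And>t. t \<in> {-1..1} \<Longrightarrow> continuous_on S (b t)"
  shows "continuous_on S (\<lambda>y. gauss_quad m (\<lambda>t. b t y))"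
  unfolding gauss_quad_def
  by (intro continuous_intros assms(2)) (use gauss_nodes_subset[OF assms(1)] in auto)

section \<open>Square linear systems\<close>

text \<open>
  Gaussian elimination: pick a pivot \<open>p\<close> in the row \<open>t\<close>, eliminate the unknown \<open>p\<close> from the other rows,
  solve these by induction, and choose the value at \<open>p\<close> so that row \<open>t\<close> holds as well.
\<close>

lemma homogeneous_system_nontrivial:
  fixes A :: "'a \<Rightarrow> 'b \<Rightarrow> 'f::field"
  assumes "finite R" "finite C" "card R < card C"
  shows "\<exists>u. (\<exists>s\<in>C. u s \<noteq> 0) \<and> (\<forall>t\<in>R. (\<Sum>s\<in>C. A t s * u s) = 0)"
  using assms
proof (induction R arbitrary: A C rule: finite_induct)
  case empty
  then obtain s where "s \<in> C" by (metis card.empty card_gt_0_iff ex_in_conv)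
  then show ?case by (intro exI[of _ "\<lambda>_. 1"]) auto
next
  case (insert t R)
  have card: "card R < card C - 1" using insert by simp
  show ?case
  proof (cases "\<forall>s\<in>C. A t s = 0")
    case True
    obtain u where "\<exists>s\<in>C. u s \<noteq> 0" "\<forall>r\<in>R. (\<Sum>s\<in>C. A r s * u s) = 0"
      using insert.IH[of C A] insert.prems card by fastforce
    with True show ?thesis by (intro exI[of _ u]) auto
  next
    case False
    then obtain p where p: "p \<in> C" "A t p \<noteq> 0" by auto
    define B where "B r s = A r s - A r p / A t p * A t s" for r s
    obtain u where u: "\<exists>s\<in>C - {p}. u s \<noteq> 0" "\<forall>r\<in>R. (\<Sum>s\<in>C - {p}. B r s * u s) = 0"
      using insert.IH[of "C - {p}" B] insert.prems card p by auto
    define c where "c = (\<Sum>s\<in>C - {p}. A t s * u s)"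
    define v where "v = u(p := - c / A t p)"
    have split: "(\<Sum>s\<in>C. A r s * v s) = (\<Sum>s\<in>C - {p}. A r s * u s) - A r p / A t p * c" for r
    proof -
      have "(\<Sum>s\<in>C - {p}. A r s * v s) = (\<Sum>s\<in>C - {p}. A r s * u s)"
        by (rule sum.cong) (auto simp: v_def)
      then show ?thesis
        using insert.prems p by (subst sum.remove[of _ p]) (auto simp: v_def field_simps)
    qed
    have "(\<Sum>s\<in>C. A r s * v s) = 0" if "r \<in> R" for r
    proof -
      have "(\<Sum>s\<in>C - {p}. B r s * u s) = (\<Sum>s\<in>C - {p}. A r s * u s) - A r p / A t p * c"
        by (simp add: B_def c_def left_diff_distrib sum_subtractf sum_distrib_left mult.assoc)
      then show ?thesis using u(2) that split by simp
    qed
    moreover have "(\<Sum>s\<in>C. A t s * v s) = 0"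
      using split[of t] p by (simp add: c_def)
    moreover have "\<exists>s\<in>C. v s \<noteq> 0" using u(1) by (auto simp: v_def)
    ultimately show ?thesis by (intro exI[of _ v]) auto
  qed
qed

text \<open>
  Adjoin the column \<open>- r\<close>, indexed by \<open>None\<close>. The enlarged homogeneous system has more unknowns than
  equations, hence a nontrivial solution; injectivity forces its \<open>None\<close>-component to be nonzero, and dividing
  by it solves the inhomogeneous system.
\<close>

lemma square_system_solvable:
  fixes A :: "'a \<Rightarrow> 'a \<Rightarrow> 'f::field"
  assumes S: "finite S"
    and inj: "\<And>u. (\<And>t. t \<in> S \<Longrightarrow> (\<Sum>s\<in>S. A t s * u s) = 0) \<Longrightarrow> \<forall>t\<in>S. u t = 0"
  obtains u where "\<And>t. t \<in> S \<Longrightarrow> (\<Sum>s\<in>S. A t s * u s) = r t"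
proof -
  let ?C = "insert None (Some ` S)"
  have "card S < card ?C" using S by (simp add: card_image)
  then obtain v where v: "\<exists>s\<in>?C. v s \<noteq> 0"
    and sol: "\<forall>t\<in>S. (\<Sum>s\<in>?C. case_option (- r t) (A t) s * v s) = 0"
    using homogeneous_system_nontrivial[of S ?C "\<lambda>t. case_option (- r t) (A t)"] S by auto
  have sol': "(\<Sum>s\<in>S. A t s * v (Some s)) = r t * v None" if "t \<in> S" for t
    using sol that S by (auto simp: sum.reindex)
  have "v None \<noteq> 0"
  proof
    assume "v None = 0"
    with inj[of "\<lambda>s. v (Some s)"] sol' v show False by auto
  qed
  then have "(\<Sum>s\<in>S. A t s * (v (Some s) / v None)) = r t" if "t \<in> S" for t
    using sol'[OF that] by (simp flip: sum_divide_distrib)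
  then show thesis by (rule that)
qed

section \<open>The discretized linear equation of the second kind\<close>

text \<open>
  A bound, uniform in \<open>m\<close>, for the inverses of the operators \<open>I - K\<^sub>m\<close>. If there were none, one could
  find \<open>\<phi>\<^sub>n\<close> of norm 1 and \<open>m\<^sub>n\<close> tending to infinity with \<open>\<phi>\<^sub>n - K\<^sub>m\<^sub>n \<phi>\<^sub>n\<close> tending to 0. The functions
  \<open>K\<^sub>m\<^sub>n \<phi>\<^sub>n\<close> are bounded and equicontinuous, as their modulus of continuity comes from the
  kernel alone. So a subsequence of them, and with it of \<open>\<phi>\<^sub>n\<close>, converges uniformly to some \<open>\<psi>\<close> of norm 1,
  and passing to the limit in the quadrature sums gives \<open>\<psi> = K \<psi>\<close>.
\<close>

lemma gauss_quad_stability: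
  fixes a :: "real \<Rightarrow> real \<Rightarrow> real"
  assumes a: "continuous_on ({-1..1} \<times> {-1..1}) (\<lambda>(x, y). a x y)"
    and inj: "\<And>\<psi>. \<lbrakk>continuous_on {-1..1} \<psi>; \<And>y. y \<in> {-1..1} \<Longrightarrow> \<psi> y = integral {-1..1} (\<lambda>x. a x y * \<psi> x)\<rbrakk>
                 \<Longrightarrow> \<forall>y\<in>{-1..1}. \<psi> y = 0"
  obtains C m0 where "C > 0" "m0 \<ge> 1"
    "\<And>m \<phi> \<rho> y. \<lbrakk>m \<ge> m0; continuous_on {-1..1} \<phi>;
        \<And>y. y \<in> {-1..1} \<Longrightarrow> \<bar>\<phi> y - gauss_quad m (\<lambda>t. a t y * \<phi> t)\<bar> \<le> \<rho>; y \<in> {-1..1}\<rbrakk>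
      \<Longrightarrow> \<bar>\<phi> y\<bar> \<le> C * \<rho>"
proof (rule ccontr)
  assume "\<not> thesis"
  \<comment> \<open>A violation of the stability bound with constant \<open>n + 1\<close>, scaled to maximum norm 1, has this form.\<close>
  define almost_null where "almost_null n m \<phi> \<longleftrightarrow> m \<ge> Suc n \<and> continuous_on {-1..1} \<phi>
      \<and> (\<forall>y\<in>{-1..1}. \<bar>\<phi> y\<bar> \<le> 1) \<and> (\<exists>y\<in>{-1..1}. \<bar>\<phi> y\<bar> = 1)
      \<and> (\<forall>y\<in>{-1..1}. \<bar>\<phi> y - gauss_quad m (\<lambda>t. a t y * \<phi> t)\<bar> \<le> 1 / Suc n)" for n m \<phi>
  have "\<exists>m \<phi>. almost_null n m \<phi>" for n
  proof -
    have "\<not> (\<forall>m \<phi> \<rho> y. m \<ge> Suc n \<longrightarrow> continuous_on {-1..1} \<phi> \<longrightarrow>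
        (\<forall>y\<in>{-1..1}. \<bar>\<phi> y - gauss_quad m (\<lambda>t. a t y * \<phi> t)\<bar> \<le> \<rho>) \<longrightarrow> y \<in> {-1..1} \<longrightarrow>
        \<bar>\<phi> y\<bar> \<le> real (Suc n) * \<rho>)" (is "\<not> ?stable")
    proof
      assume stable: ?stable
      have thesis
      proof (rule that)
        show "real (Suc n) > 0" "Suc n \<ge> 1" by auto
      qed (rule stable[rule_format])
      with \<open>\<not> thesis\<close> show False ..
    qed
    then obtain m \<phi> \<rho> y0 where m: "m \<ge> Suc n" and \<phi>: "continuous_on {-1..1} \<phi>"
      and res: "\<And>y. y \<in> {-1..1} \<Longrightarrow> \<bar>\<phi> y - gauss_quad m (\<lambda>t. a t y * \<phi> t)\<bar> \<le> \<rho>"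
      and y0: "y0 \<in> {-1..1}" "\<bar>\<phi> y0\<bar> > real (Suc n) * \<rho>"
      unfolding not_all not_imp not_le by blast
    have "continuous_on {-1..1} (\<lambda>y. \<bar>\<phi> y\<bar>)" using \<phi> by (intro continuous_intros)
    from continuous_attains_sup[OF compact_Icc _ this]
    obtain z where z: "z \<in> {-1..1}" "\<And>y. y \<in> {-1..1} \<Longrightarrow> \<bar>\<phi> y\<bar> \<le> \<bar>\<phi> z\<bar>"
      using y0(1) by blast
    define N where "N = \<bar>\<phi> z\<bar>"
    have \<rho>: "0 \<le> \<rho>" using res[OF y0(1)] by linarith
    have N: "real (Suc n) * \<rho> < N" using z(2)[OF y0(1)] y0 by (simp add: N_def)
    then have N0: "N > 0" using \<rho> by (smt (verit) mult_nonneg_nonneg of_nat_0_le_iff)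
    have "gauss_quad m (\<lambda>t. a t y * (\<phi> t / N)) = gauss_quad m (\<lambda>t. a t y * \<phi> t) / N" for y
      by (simp add: gauss_quad_def sum_divide_distrib)
    then have "\<bar>\<phi> y / N - gauss_quad m (\<lambda>t. a t y * (\<phi> t / N))\<bar> = \<bar>\<phi> y - gauss_quad m (\<lambda>t. a t y * \<phi> t)\<bar> / N" for y
      using N0 by (simp flip: diff_divide_distrib)
    moreover have "\<rho> / N \<le> 1 / Suc n" using N N0 by (simp add: field_simps)
    ultimately have "\<bar>\<phi> y / N - gauss_quad m (\<lambda>t. a t y * (\<phi> t / N))\<bar> \<le> 1 / Suc n" if "y \<in> {-1..1}" for y
      using divide_right_mono[OF res[OF that], of N] N0 by simp
    moreover have "\<bar>\<phi> y / N\<bar> \<le> 1" if "y \<in> {-1..1}" for y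
      using z(2)[OF that] N0 by (simp add: N_def)
    moreover have "\<bar>\<phi> z / N\<bar> = 1" using N0 by (simp add: N_def)
    moreover have "continuous_on {-1..1} (\<lambda>y. \<phi> y / N)" using \<phi> N0 by (intro continuous_intros) auto
    ultimately have "almost_null n m (\<lambda>y. \<phi> y / N)"
      unfolding almost_null_def using m z(1) by blast
    then show ?thesis by blast
  qed
  then obtain \<mu> \<phi> where "\<And>n. almost_null n (\<mu> n) (\<phi> n)" by metis
  then have \<mu>: "\<mu> n \<ge> Suc n" and \<phi>: "continuous_on {-1..1} (\<phi> n)"
    and bound: "y \<in> {-1..1} \<Longrightarrow> \<bar>\<phi> n y\<bar> \<le> 1" and unit: "\<exists>y\<in>{-1..1}. \<bar>\<phi> n y\<bar> = 1"
    and res: "y \<in> {-1..1} \<Longrightarrow> \<bar>\<phi> n y - gauss_quad (\<mu> n) (\<lambda>t. a t y * \<phi> n t)\<bar> \<le> 1 / Suc n" for n y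
    unfolding almost_null_def by blast+
  have \<mu>1: "\<mu> n \<ge> 1" for n using \<mu>[of n] by linarith
  define F where "F n y = gauss_quad (\<mu> n) (\<lambda>t. a t y * \<phi> n t)" for n y
  obtain A where A: "A > 0" "\<And>x y. x \<in> {-1..1} \<Longrightarrow> y \<in> {-1..1} \<Longrightarrow> \<bar>a x y\<bar> \<le> A"
    using kernel_bounded[OF a] by blast
  have F_bound: "norm (F n y) \<le> 2 * A" if "y \<in> {-1..1}" for n y
    unfolding F_def real_norm_def
    by (intro gauss_quad_bound \<mu>1)
       (use A(2)[OF _ that] bound A(1) in \<open>force simp: abs_mult intro: order_trans[OF mult_mono]\<close>)
  have F_equi: "\<exists>d>0. \<forall>n y'. y' \<in> {-1..1} \<and> norm (y - y') < d \<longrightarrow> norm (F n y - F n y') < e"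
    if y: "y \<in> {-1..1}" and e: "e > 0" for y e :: real
  proof -
    obtain d where d: "d > 0"
      and near: "\<And>x y y'. \<lbrakk>x \<in> {-1..1}; y \<in> {-1..1}; y' \<in> {-1..1}; \<bar>y - y'\<bar> < d\<rbrakk> \<Longrightarrow> \<bar>a x y - a x y'\<bar> < e / 3"
      using kernel_equicontinuous[OF a, of "e / 3"] e by auto
    have "norm (F n y - F n y') < e" if y': "y' \<in> {-1..1}" "norm (y - y') < d" for n y'
    proof -
      have "\<bar>a t y * \<phi> n t - a t y' * \<phi> n t\<bar> \<le> e / 3" if t: "t \<in> {-1..1}" for t
      proof -
        have "\<bar>a t y * \<phi> n t - a t y' * \<phi> n t\<bar> = \<bar>a t y - a t y'\<bar> * \<bar>\<phi> n t\<bar>"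
          by (simp add: left_diff_distrib flip: abs_mult)
        also have "\<dots> \<le> e / 3 * 1"
          using near[OF t y y'(1)] y'(2) bound[OF t, of n] e by (intro mult_mono) auto
        finally show ?thesis by simp
      qed
      then have "\<bar>F n y - F n y'\<bar> \<le> 2 * (e / 3)"
        unfolding F_def gauss_quad_diff[symmetric] by (intro gauss_quad_bound \<mu>1)
      then show ?thesis using e by simp
    qed
    with d show ?thesis by blast
  qed
  obtain \<psi> and r :: "nat \<Rightarrow> nat" where \<psi>: "continuous_on {-1..1} \<psi>" and r: "strict_mono r"
    and conv: "\<And>e. 0 < e \<Longrightarrow> \<exists>N. \<forall>n x. n \<ge> N \<and> x \<in> {-1..1} \<longrightarrow> norm (F (r n) x - \<psi> x) < e"
    using Arzela_Ascoli[OF compact_Icc F_bound F_equi] by blast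
  \<comment> \<open>Since the residuals tend to 0, \<open>\<phi> (r n)\<close> has the same uniform limit as \<open>F (r n)\<close>.\<close>
  have conv': "\<forall>\<^sub>F n in sequentially. \<forall>y\<in>{-1..1}. \<bar>\<phi> (r n) y - \<psi> y\<bar> < e" if e: "e > 0" for e
  proof -
    obtain N where N: "\<And>n x. n \<ge> N \<Longrightarrow> x \<in> {-1..1} \<Longrightarrow> norm (F (r n) x - \<psi> x) < e / 2"
      using conv[of "e / 2"] e by auto
    obtain N' where N': "1 / real (Suc N') < e / 2"
      using e reals_Archimedean[of "e / 2"] by (auto simp: inverse_eq_divide)
    have "\<bar>\<phi> (r n) y - \<psi> y\<bar> < e" if n: "n \<ge> max N N'" and y: "y \<in> {-1..1}" for n y
    proof -
      have "Suc N' \<le> Suc (r n)" using seq_suble[OF r, of n] n by simp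
      then have "1 / real (Suc (r n)) \<le> 1 / real (Suc N')" by (intro divide_left_mono) auto
      then show ?thesis
        using res[OF y, of "r n"] N[of n y] n y N' unfolding F_def real_norm_def by linarith
    qed
    then show ?thesis unfolding eventually_sequentially by blast
  qed
  have "\<psi> y = integral {-1..1} (\<lambda>x. a x y * \<psi> x)" if y: "y \<in> {-1..1}" for y
  proof (rule LIMSEQ_unique)
    show "(\<lambda>n. F (r n) y) \<longlonglongrightarrow> \<psi> y"
      using conv y by (intro LIMSEQ_I) blast
    have "\<forall>\<^sub>F n in sequentially. n \<le> \<mu> n"
      using Suc_leD[OF \<mu>] by simp
    then have "filterlim \<mu> at_top sequentially"
      by (rule filterlim_at_top_mono[OF filterlim_ident])
    then have "filterlim (\<lambda>n. \<mu> (r n)) at_top sequentially"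
      by (rule filterlim_compose) (rule filterlim_subseq[OF r])
    then have "(\<lambda>n. gauss_quad (\<mu> (r n)) (\<lambda>x. a x y * \<psi> x)) \<longlonglongrightarrow> integral {-1..1} (\<lambda>x. a x y * \<psi> x)"
      by (rule filterlim_compose[OF gauss_quad_tendsto_integral, rotated])
         (intro continuous_intros \<psi> continuous_on_kernel_section(2)[OF a y])
    moreover have "(\<lambda>n. F (r n) y - gauss_quad (\<mu> (r n)) (\<lambda>x. a x y * \<psi> x)) \<longlonglongrightarrow> 0"
    proof (rule tendstoI)
      fix e :: real assume e: "e > 0"
      have "0 < e / (3 * A)" using e A(1) by simp
      from conv'[OF this]
      show "\<forall>\<^sub>F n in sequentially. dist (F (r n) y - gauss_quad (\<mu> (r n)) (\<lambda>x. a x y * \<psi> x)) 0 < e"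
      proof eventually_elim
        fix n assume n: "\<forall>y\<in>{-1..1}. \<bar>\<phi> (r n) y - \<psi> y\<bar> < e / (3 * A)"
        have "\<bar>a x y * \<phi> (r n) x - a x y * \<psi> x\<bar> \<le> e / 3" if x: "x \<in> {-1..1}" for x
        proof -
          have "\<bar>a x y * \<phi> (r n) x - a x y * \<psi> x\<bar> = \<bar>a x y\<bar> * \<bar>\<phi> (r n) x - \<psi> x\<bar>"
            by (simp add: right_diff_distrib flip: abs_mult)
          also have "\<dots> \<le> A * (e / (3 * A))"
            using A(1) A(2)[OF x y] n[rule_format, OF x] by (intro mult_mono) auto
          finally show ?thesis using A(1) by simp
        qed
        then have "\<bar>F (r n) y - gauss_quad (\<mu> (r n)) (\<lambda>x. a x y * \<psi> x)\<bar> \<le> 2 * (e / 3)"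
          unfolding F_def gauss_quad_diff[symmetric] by (intro gauss_quad_bound \<mu>1)
        then show "dist (F (r n) y - gauss_quad (\<mu> (r n)) (\<lambda>x. a x y * \<psi> x)) 0 < e" using e by simp
      qed
    qed
    ultimately have "(\<lambda>n. gauss_quad (\<mu> (r n)) (\<lambda>x. a x y * \<psi> x)
        + (F (r n) y - gauss_quad (\<mu> (r n)) (\<lambda>x. a x y * \<psi> x))) \<longlonglongrightarrow> integral {-1..1} (\<lambda>x. a x y * \<psi> x) + 0"
      by (rule tendsto_add)
    then show "(\<lambda>n. F (r n) y) \<longlonglongrightarrow> integral {-1..1} (\<lambda>x. a x y * \<psi> x)" by simp
  qed
  then have \<psi>0: "\<forall>y\<in>{-1..1}. \<psi> y = 0" using inj[OF \<psi>] by blast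
  obtain n where "\<forall>y\<in>{-1..1}. \<bar>\<phi> (r n) y - \<psi> y\<bar> < 1"
    using conv'[of 1] by (auto simp: eventually_sequentially)
  with \<psi>0 unit[of "r n"] show False by force
qed

text \<open>
  Nystroem's method: the values \<open>u\<close> at the nodes satisfy a square linear system, and the equation itself
  extends a solution from the nodes to the whole interval, as \<open>K\<^sub>m \<phi>\<close> depends only on these values.
\<close>

lemma gauss_quad_equation_solvable:
  assumes m: "m \<ge> 1" and a: "\<And>t. t \<in> {-1..1} \<Longrightarrow> continuous_on {-1..1} (a t)"
    and r: "continuous_on {-1..1} r"
    and inj: "\<And>\<phi>. \<lbrakk>continuous_on {-1..1} \<phi>; \<And>y. y \<in> {-1..1} \<Longrightarrow> \<phi> y = gauss_quad m (\<lambda>t. a t y * \<phi> t)\<rbrakk>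
                 \<Longrightarrow> \<forall>y\<in>{-1..1}. \<phi> y = 0"
  obtains \<phi> where "continuous_on {-1..1} \<phi>"
    "\<And>y. y \<in> {-1..1} \<Longrightarrow> \<phi> y - gauss_quad m (\<lambda>t. a t y * \<phi> t) = r y"
proof -
  let ?S = "gauss_nodes m"
  note fin = finite_gauss_nodes[OF m] and sub = gauss_nodes_subset[OF m]
  \<comment> \<open>The matrix of \<open>I - K\<^sub>m\<close> on the values at the nodes.\<close>
  define A where "A t s = (if s = t then 1 else 0) - gauss_weight m s * a s t" for t s
  define Q where "Q u y = gauss_quad m (\<lambda>s. a s y * u s)" for u y
  have Q_cong: "Q u y = Q v y" if "\<And>s. s \<in> ?S \<Longrightarrow> u s = v s" for u v y
    unfolding Q_def gauss_quad_def using that by (intro sum.cong) auto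
  have Q_cont: "continuous_on {-1..1} (Q u)" for u
    unfolding Q_def by (intro continuous_on_gauss_quad m continuous_intros a)
  have A: "(\<Sum>s\<in>?S. A t s * u s) = u t - Q u t" if "t \<in> ?S" for t u
  proof -
    have "(\<Sum>s\<in>?S. A t s * u s) = (\<Sum>s\<in>?S. (if s = t then u s else 0) - gauss_weight m s * (a s t * u s))"
      by (rule sum.cong) (auto simp: A_def algebra_simps)
    then show ?thesis using that fin by (simp add: sum_subtractf Q_def gauss_quad_def)
  qed
  obtain u where u: "\<And>t. t \<in> ?S \<Longrightarrow> (\<Sum>s\<in>?S. A t s * u s) = r t"
  proof (rule square_system_solvable[OF fin, of A r])
    fix u assume "\<And>t. t \<in> ?S \<Longrightarrow> (\<Sum>s\<in>?S. A t s * u s) = 0"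
    then have ut: "u t = Q u t" if "t \<in> ?S" for t using A[OF that, of u] that by simp
    then have "Q u y = gauss_quad m (\<lambda>t. a t y * Q u t)" for y
      using Q_cong[of u "Q u" y] by (simp add: Q_def)
    from inj[OF Q_cont this] show "\<forall>t\<in>?S. u t = 0" using ut sub by auto
  qed (rule that)
  define \<phi> where "\<phi> y = r y + Q u y" for y
  have "\<phi> t = u t" if "t \<in> ?S" for t using u[OF that] A[OF that] by (simp add: \<phi>_def)
  then have "\<phi> y - gauss_quad m (\<lambda>t. a t y * \<phi> t) = r y" for y
    using Q_cong[of \<phi> u y] by (simp add: Q_def \<phi>_def)
  moreover have "continuous_on {-1..1} \<phi>"
    unfolding \<phi>_def by (intro continuous_intros r Q_cont)
  ultimately show thesis by (intro that) auto
qed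

section \<open>Contractions on closed balls\<close>

text \<open>
  Banach's fixed point theorem for a contraction defined on a closed ball only: the condition on the
  displacement of the centre makes the ball invariant.
\<close>

lemma (in Metric_space) contraction_fixpoint_mcball:
  assumes "mcomplete" and x0: "x0 \<in> M"
    and q: "0 \<le> q" "q < 1"
    and T: "\<And>x. x \<in> mcball x0 r \<Longrightarrow> T x \<in> M"
    and contr: "\<And>x y. \<lbrakk>x \<in> mcball x0 r; y \<in> mcball x0 r\<rbrakk> \<Longrightarrow> d (T x) (T y) \<le> q * d x y"
    and start: "d x0 (T x0) \<le> (1 - q) * r"
  shows "\<exists>!x. x \<in> mcball x0 r \<and> T x = x"
proof (rule ex_ex1I)
  have r: "0 \<le> r"
    using order_trans[OF nonneg start] q by (simp add: zero_le_mult_iff)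
  have self: "T x \<in> mcball x0 r" if x: "x \<in> mcball x0 r" for x
  proof -
    have "d x0 (T x) \<le> d x0 (T x0) + d (T x0) (T x)"
      using x x0 T r by (intro triangle) auto
    also have "\<dots> \<le> (1 - q) * r + q * r"
      using contr[of x0 x] x x0 r start q
      by (intro add_mono) (auto intro: order_trans mult_left_mono)
    finally show ?thesis using T[OF x] x0 by (simp add: algebra_simps)
  qed
  define \<sigma> where "\<sigma> n = (T ^^ n) x0" for n
  have ball: "\<sigma> n \<in> mcball x0 r" for n
    by (induction n) (use self x0 r in \<open>auto simp: \<sigma>_def\<close>)
  then have in_M: "\<sigma> n \<in> M" for n by auto
  have Suc: "\<sigma> (Suc n) = T (\<sigma> n)" for n by (simp add: \<sigma>_def)
  have iter: "d (\<sigma> n) (\<sigma> (n + k)) \<le> q ^ n * r" for n k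
  proof (induction n)
    case 0
    show ?case using ball[of k] x0 by (simp add: \<sigma>_def)
  next
    case (Suc n)
    have "d (\<sigma> (Suc n)) (\<sigma> (Suc n + k)) \<le> q * d (\<sigma> n) (\<sigma> (n + k))"
      using contr[OF ball ball] by (simp add: \<open>\<And>n. \<sigma> (Suc n) = T (\<sigma> n)\<close>)
    then show ?case using mult_left_mono[OF Suc q(1)] by (simp add: mult.assoc)
  qed
  have lim0: "(\<lambda>n. q ^ n * r) \<longlonglongrightarrow> 0"
    using tendsto_mult_right[OF LIMSEQ_realpow_zero[OF q]] by simp
  have "MCauchy \<sigma>"
    unfolding MCauchy_def
  proof (intro conjI allI impI)
    fix e :: real assume "e > 0"
    then obtain N where N: "\<And>n. n \<ge> N \<Longrightarrow> q ^ n * r < e"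
      using order_tendstoD(2)[OF lim0] by (auto simp: eventually_sequentially)
    have "d (\<sigma> n) (\<sigma> n') < e" if "N \<le> n" "n \<le> n'" for n n'
      using iter[of n "n' - n"] N[of n] that by simp
    then have "d (\<sigma> n) (\<sigma> n') < e" if "N \<le> n" "N \<le> n'" for n n'
      using that by (metis commute nle_le)
    then show "\<exists>N. \<forall>n n'. N \<le> n \<longrightarrow> N \<le> n' \<longrightarrow> d (\<sigma> n) (\<sigma> n') < e" by blast
  qed (use in_M in auto)
  then obtain x where x: "limitin mtopology \<sigma> x sequentially"
    using \<open>mcomplete\<close> by (auto simp: mcomplete_def)
  then have xM: "x \<in> M" by (rule limitin_mspace)
  have xb: "x \<in> mcball x0 r"
    using limitin_closedin[OF x closedin_mcball[of x0 r]] ball by simp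
  have dlim: "(\<lambda>n. d (\<sigma> n) x) \<longlonglongrightarrow> 0"
    using x by (simp add: limitin_metric_dist_null)
  have "d (T x) x \<le> d (\<sigma> n) x + d (\<sigma> (Suc n)) x" for n
  proof -
    have "d (T x) x \<le> d (T x) (T (\<sigma> n)) + d (T (\<sigma> n)) x"
      using T ball xb xM by (intro triangle) auto
    moreover have "d (T x) (T (\<sigma> n)) \<le> q * d x (\<sigma> n)" using contr[OF xb ball] .
    moreover have "q * d x (\<sigma> n) \<le> 1 * d x (\<sigma> n)" using q nonneg by (intro mult_right_mono) auto
    ultimately show ?thesis using commute[of x "\<sigma> n"] Suc[of n] by simp
  qed
  moreover have "(\<lambda>n. d (\<sigma> n) x + d (\<sigma> (Suc n)) x) \<longlonglongrightarrow> 0 + 0"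
    by (intro tendsto_add dlim LIMSEQ_Suc)
  ultimately have "d (T x) x \<le> 0"
    by (intro LIMSEQ_le_const[where X = "\<lambda>n. d (\<sigma> n) x + d (\<sigma> (Suc n)) x"]) auto
  then have "T x = x" using zero[OF T[OF xb] xM] nonneg by (simp add: order_antisym)
  with xb show "\<exists>x. x \<in> mcball x0 r \<and> T x = x" by blast
next
  fix x y assume x: "x \<in> mcball x0 r \<and> T x = x" and y: "y \<in> mcball x0 r \<and> T y = y"
  then have "d x y \<le> q * d x y" using contr[of x y] by simp
  then have "(1 - q) * d x y \<le> 0" by (simp add: algebra_simps)
  then have "d x y \<le> 0" using q by (simp add: mult_le_0_iff)
  then show "x = y" using x y zero[of x y] nonneg[of x y] by auto
qed

lemma mdist_C0_le_iff:
  assumes "f \<in> mspace C0" "g \<in> mspace C0"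
  shows "mdist C0 f g \<le> d \<longleftrightarrow> (\<forall>x\<in>{-1..1}. \<bar>f x - g x\<bar> \<le> d)"
  using assms by (simp add: C0_def cfunspace_mdist_le dist_real_def del: mspace_cfunspace)

lemma abs_diff_le_mdist_C0:
  assumes "f \<in> mspace C0" "g \<in> mspace C0" "x \<in> {-1..1}"
  shows "\<bar>f x - g x\<bar> \<le> mdist C0 f g"
  using mdist_C0_le_iff[OF assms(1,2), of "mdist C0 f g"] assms(3) by simp

lemma mcomplete_of_C0: "mcomplete_of C0"
  using Met_TC.mcomplete_cfunspace[where 'a = real, of "top_of_set {-1..1}"]
  by (simp add: C0_def complete_UNIV Met_TC.Self_def euclidean_metric_def)

lemma restrict_mem_C0:
  assumes "continuous_on {-1..1} f"
  shows "restrict f {-1..1} \<in> mspace C0"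
  unfolding mem_C0_iff using continuous_on_eq[OF assms, of "restrict f {-1..1}"] by simp

lemma contraction_fixpoint_mcball_of:
  assumes "mcomplete_of M" and "x0 \<in> mspace M"
    and "0 \<le> q" "q < 1"
    and "\<And>x. x \<in> mcball_of M x0 r \<Longrightarrow> T x \<in> mspace M"
    and "\<And>x y. \<lbrakk>x \<in> mcball_of M x0 r; y \<in> mcball_of M x0 r\<rbrakk>
           \<Longrightarrow> mdist M (T x) (T y) \<le> q * mdist M x y"
    and "mdist M x0 (T x0) \<le> (1 - q) * r"
  shows "\<exists>!x. x \<in> mcball_of M x0 r \<and> T x = x"
  unfolding mcball_of_def
  by (rule Metric_space.contraction_fixpoint_mcball[OF Metric_space_mspace_mdist])
     (use assms in \<open>simp_all add: mcomplete_of_def mcball_of_def\<close>)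

section \<open>Linearization in a tube around a continuous function\<close>

text \<open>
  The mean value theorem for \<open>h v - c * v\<close>, whose derivative \<open>hv v - c\<close> is small.
\<close>

lemma partial_deriv_remainder_bound:
  fixes h hv :: "real \<Rightarrow> real"
  assumes deriv: "\<And>v. v \<in> {a..b} \<Longrightarrow> (h has_real_derivative hv v) (at v within {a..b})"
    and close: "\<And>v. v \<in> {a..b} \<Longrightarrow> \<bar>hv v - c\<bar> \<le> \<eta>"
    and "u \<in> {a..b}" "w \<in> {a..b}"
  shows "\<bar>h u - h w - c * (u - w)\<bar> \<le> \<eta> * \<bar>u - w\<bar>"
proof -
  have "((\<lambda>v. h v - c * v) has_real_derivative hv v - c) (at v within {a..b})" if "v \<in> {a..b}" for v
    using deriv[OF that] by (auto intro!: derivative_eq_intros)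
  then have "norm ((h u - c * u) - (h w - c * w)) \<le> \<eta> * norm (u - w)"
    using assms(3,4) close by (intro field_differentiable_bound[of "{a..b}" _ "\<lambda>v. hv v - c"]) auto
  then show ?thesis by (simp add: algebra_simps)
qed

text \<open>
  The tube is the image of a rectangle under the shear \<open>(x, s) \<mapsto> (x, f x + s)\<close>.
\<close>

lemma compact_tube:
  assumes "continuous_on {-1..1} (f :: real \<Rightarrow> real)"
  shows "compact {(x, v). x \<in> {-1..1::real} \<and> \<bar>v - f x\<bar> \<le> \<delta>}"
proof -
  let ?\<Phi> = "\<lambda>(x, s). (x, f x + s)"
  have "{(x, v). x \<in> {-1..1::real} \<and> \<bar>v - f x\<bar> \<le> \<delta>} = ?\<Phi> ` ({-1..1} \<times> {-\<delta>..\<delta>})"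
  proof (intro set_eqI iffI)
    fix p assume "p \<in> {(x, v). x \<in> {-1..1::real} \<and> \<bar>v - f x\<bar> \<le> \<delta>}"
    then obtain x v where "p = (x, v)" "x \<in> {-1..1}" "\<bar>v - f x\<bar> \<le> \<delta>" by auto
    then show "p \<in> ?\<Phi> ` ({-1..1} \<times> {-\<delta>..\<delta>})"
      by (intro image_eqI[of _ _ "(x, v - f x)"]) (auto simp: abs_le_iff)
  qed (auto simp: abs_le_iff)
  moreover have "continuous_on ({-1..1} \<times> {-\<delta>..\<delta>}) ?\<Phi>"
    unfolding case_prod_beta
    by (intro continuous_intros continuous_on_compose2[OF assms]) auto
  ultimately show ?thesis by (simp add: compact_continuous_image compact_Times)
qed

lemma tube_uniformly_close:
  fixes f :: "real \<Rightarrow> real"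
  assumes f: "continuous_on {-1..1} f"
    and hv: "continuous_on {(x, v). x \<in> {-1..1} \<and> \<bar>v - f x\<bar> \<le> \<delta>} (\<lambda>(x, v). hv x v)"
    and pos: "\<delta> > 0" "\<eta> > 0"
  obtains \<epsilon> where "0 < \<epsilon>" "\<epsilon> \<le> \<delta>"
    "\<And>x v. \<lbrakk>x \<in> {-1..1}; \<bar>v - f x\<bar> \<le> \<epsilon>\<rbrakk> \<Longrightarrow> \<bar>hv x v - hv x (f x)\<bar> \<le> (\<eta> :: real)"
proof -
  let ?K = "{(x, v). x \<in> {-1..1} \<and> \<bar>v - f x\<bar> \<le> \<delta>}"
  have "uniformly_continuous_on ?K (\<lambda>(x, v). hv x v)"
    by (intro compact_uniformly_continuous hv compact_tube f)
  from this[unfolded uniformly_continuous_on_def, rule_format, OF pos(2)]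
  obtain d where d: "d > 0"
    and unif: "\<forall>p\<in>?K. \<forall>p'\<in>?K. dist p' p < d \<longrightarrow> dist ((\<lambda>(x, v). hv x v) p') ((\<lambda>(x, v). hv x v) p) < \<eta>"
    by blast
  show thesis
  proof (rule that[of "min \<delta> (d / 2)"])
    fix x v assume x: "x \<in> {-1..1}" and v: "\<bar>v - f x\<bar> \<le> min \<delta> (d / 2)"
    then have "(x, f x) \<in> ?K" "(x, v) \<in> ?K" "dist (x, v) (x, f x) < d"
      using pos d by (auto simp: dist_Pair_Pair dist_real_def)
    then have "dist ((\<lambda>(x, v). hv x v) (x, v)) ((\<lambda>(x, v). hv x v) (x, f x)) < \<eta>"
      using unif[rule_format, of "(x, f x)" "(x, v)"] by simp
    then show "\<bar>hv x v - hv x (f x)\<bar> \<le> \<eta>" by (simp add: dist_real_def)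
  qed (use pos d in auto)
qed

section \<open>Fixed points of the discretized operators\<close>

theorem theorem4p2:
  fixes k1 k2 h hv hvv :: "real \<Rightarrow> real \<Rightarrow> real" and g fstar :: "real \<Rightarrow> real" and \<delta> :: real
  assumes kernels: "\<forall>k\<in>{k1, k2}. continuous_on ({-1..1} \<times> {-1..1}) (\<lambda>(x, y). k x y)"
    and fstar_C0: "fstar \<in> mspace C0"
    and fixpoint: "G_op k1 k2 h g fstar = fstar"
    and delta: "\<delta> > 0"
    and K1_bdd: "\<forall>k\<in>{k1, k2}. bdd_above ((\<lambda>y. integral {-1..1} (\<lambda>x. \<bar>k x y\<bar>)) ` {-1..1})"
    and K1_lim: "\<forall>k\<in>{k1, k2}. \<forall>y0\<in>{-1..1}.
          ((\<lambda>y. integral {-1..1} (\<lambda>x. \<bar>k x y - k x y0\<bar>)) \<longlongrightarrow> 0) (at y0 within {-1..1})"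
    and H1: "continuous_on ({-1..1} \<times> UNIV) (\<lambda>(x, v). h x v)"
    and G1: "continuous_on {-1..1} g"
    and H2: "\<forall>x\<in>{-1..1}. \<forall>v\<in>{fstar x - \<delta>..fstar x + \<delta>}.
          (h x has_real_derivative hv x v) (at v within {fstar x - \<delta>..fstar x + \<delta>})"
    and H2_cont: "continuous_on {(x, v). x \<in> {-1..1} \<and> \<bar>v - fstar x\<bar> \<le> \<delta>} (\<lambda>(x, v). hv x v)"
    and H3: "\<forall>x\<in>{-1..1}. \<forall>v\<in>{fstar x - \<delta>..fstar x + \<delta>}.
          (hv x has_real_derivative hvv x v) (at v within {fstar x - \<delta>..fstar x + \<delta>})"
    and H3_cont: "continuous_on {(x, v). x \<in> {-1..1} \<and> \<bar>v - fstar x\<bar> \<le> \<delta>} (\<lambda>(x, v). hvv x v)"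
    and not_eigenvalue: "\<not> is_eigenvalue_C0 (G_deriv k1 k2 hv fstar) 1"
  shows "\<exists>\<epsilon>>0. \<epsilon> \<le> \<delta> \<and>
           (\<exists>m0::nat. \<forall>m\<ge>m0. \<exists>!f. f \<in> mcball_of C0 fstar \<epsilon> \<and> Gm_op k1 k2 h g m f = f)"
proof -
  have k1: "continuous_on ({-1..1} \<times> {-1..1}) (\<lambda>(x, y). k1 x y)"
    and k2: "continuous_on ({-1..1} \<times> {-1..1}) (\<lambda>(x, y). k2 x y)"
    using kernels by auto
  have fstar: "continuous_on {-1..1} fstar" using fstar_C0 by (simp add: mem_C0_iff)
  define H where "H f x = h x (f x)" for f x
  define c where "c x = hv x (fstar x)" for x
  have H_cont: "continuous_on {-1..1} (H f)" if "continuous_on {-1..1} f" for f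
  proof -
    have "continuous_on {-1..1} (\<lambda>x. (x, f x))" by (intro continuous_intros that)
    from continuous_on_compose2[OF H1 this] show ?thesis by (force simp: H_def)
  qed
  have c_cont: "continuous_on {-1..1} c"
  proof -
    have "continuous_on {-1..1} (\<lambda>x. (x, fstar x))" by (intro continuous_intros fstar)
    from continuous_on_compose2[OF H2_cont this] show ?thesis using delta by (force simp: c_def)
  qed
  define a where "a x y = k1 x y + k2 x y * c x" for x y
  have mult_kernel: "continuous_on ({-1..1} \<times> {-1..1}) (\<lambda>(x, y). k x y * u x)"
    if "continuous_on ({-1..1} \<times> {-1..1}) (\<lambda>(x, y). k x y)" "continuous_on {-1..1} u"
    for k :: "real \<Rightarrow> real \<Rightarrow> real" and u
    using continuous_on_mult[OF that(1) continuous_on_compose2[OF that(2) continuous_on_fst[OF continuous_on_id]]]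
    by (auto simp: case_prod_beta)
  have a_cont: "continuous_on ({-1..1} \<times> {-1..1}) (\<lambda>(x, y). a x y)"
    using continuous_on_add[OF k1 mult_kernel[OF k2 c_cont]] by (simp add: a_def case_prod_beta)
  note k1_sect = continuous_on_kernel_section[OF k1] and k2_sect = continuous_on_kernel_section[OF k2]
    and a_sect = continuous_on_kernel_section[OF a_cont]

  \<comment> \<open>A nonzero solution of the homogeneous equation would restrict to an eigenfunction on \<open>[-1,1]\<close>.\<close>
  have inj: "\<forall>y\<in>{-1..1}. \<psi> y = 0"
    if \<psi>: "continuous_on {-1..1} \<psi>"
      and eig: "\<And>y. y \<in> {-1..1} \<Longrightarrow> \<psi> y = integral {-1..1} (\<lambda>x. a x y * \<psi> x)" for \<psi>
  proof -
    let ?\<psi> = "restrict \<psi> {-1..1}"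
    have int_cong: "integral {-1..1} (\<lambda>x. u x * ?\<psi> x) = integral {-1..1} (\<lambda>x. u x * \<psi> x)" for u :: "real \<Rightarrow> real"
      by (rule integral_cong) simp
    have "G_deriv k1 k2 hv fstar ?\<psi> = (\<lambda>y\<in>{-1..1}. 1 * ?\<psi> y)"
      unfolding G_deriv_def int_cong
    proof (rule restrict_ext)
      fix y :: real assume y: "y \<in> {-1..1}"
      have "integral {-1..1} (\<lambda>x. k1 x y * \<psi> x) + integral {-1..1} (\<lambda>x. k2 x y * hv x (fstar x) * \<psi> x)
          = integral {-1..1} (\<lambda>x. k1 x y * \<psi> x + k2 x y * c x * \<psi> x)"
        unfolding c_def[symmetric]
        by (intro integral_add[symmetric] integrable_continuous_interval continuous_intros
            k1_sect(2) k2_sect(2) y \<psi> c_cont)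
      also have "\<dots> = integral {-1..1} (\<lambda>x. a x y * \<psi> x)" by (simp add: a_def distrib_right)
      also have "\<dots> = 1 * ?\<psi> y" using eig[OF y] y by simp
      finally show "integral {-1..1} (\<lambda>x. k1 x y * \<psi> x)
          + integral {-1..1} (\<lambda>x. k2 x y * hv x (fstar x) * \<psi> x) = 1 * ?\<psi> y" .
    qed
    moreover note restrict_mem_C0[OF \<psi>]
    ultimately have restrict_0: "?\<psi> = (\<lambda>x\<in>{-1..1}. 0)"
      using not_eigenvalue unfolding is_eigenvalue_C0_def by blast
    show ?thesis
    proof
      fix y :: real assume "y \<in> {-1..1}"
      with fun_cong[OF restrict_0, of y] show "\<psi> y = 0" by simp
    qed
  qed
  obtain C m0 where C: "C > 0" and m0: "m0 \<ge> 1"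
    and stable: "\<And>m \<phi> \<rho> y. \<lbrakk>m \<ge> m0; continuous_on {-1..1} \<phi>;
        \<And>y. y \<in> {-1..1} \<Longrightarrow> \<bar>\<phi> y - gauss_quad m (\<lambda>t. a t y * \<phi> t)\<bar> \<le> \<rho>; y \<in> {-1..1}\<rbrakk>
      \<Longrightarrow> \<bar>\<phi> y\<bar> \<le> C * \<rho>"
    using gauss_quad_stability[OF a_cont inj] by blast

  obtain B where B: "B > 0" "\<And>x y. x \<in> {-1..1} \<Longrightarrow> y \<in> {-1..1} \<Longrightarrow> \<bar>k2 x y\<bar> \<le> B"
    using kernel_bounded[OF k2] by blast
  \<comment> \<open>Chosen so that the contraction constant \<open>C * (2 * (B * \<eta>))\<close> below is \<open>1 / 2\<close>.\<close>
  define \<eta> where "\<eta> = 1 / (4 * C * B)"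
  have \<eta>: "\<eta> > 0" using B C by (simp add: \<eta>_def)
  obtain \<epsilon> where \<epsilon>: "0 < \<epsilon>" "\<epsilon> \<le> \<delta>"
    and close: "\<And>x v. \<lbrakk>x \<in> {-1..1}; \<bar>v - fstar x\<bar> \<le> \<epsilon>\<rbrakk> \<Longrightarrow> \<bar>hv x v - c x\<bar> \<le> \<eta>"
    using tube_uniformly_close[OF fstar H2_cont delta \<eta>] unfolding c_def by blast
  have h_lin: "\<bar>h x u - h x w - c x * (u - w)\<bar> \<le> \<eta> * \<bar>u - w\<bar>"
    if x: "x \<in> {-1..1}" and "\<bar>u - fstar x\<bar> \<le> \<epsilon>" "\<bar>w - fstar x\<bar> \<le> \<epsilon>" for x u w
  proof (rule partial_deriv_remainder_bound[where a = "fstar x - \<epsilon>" and b = "fstar x + \<epsilon>"])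
    fix v assume v: "v \<in> {fstar x - \<epsilon>..fstar x + \<epsilon>}"
    show "(h x has_real_derivative hv x v) (at v within {fstar x - \<epsilon>..fstar x + \<epsilon>})"
    proof (rule DERIV_subset)
      show "(h x has_real_derivative hv x v) (at v within {fstar x - \<delta>..fstar x + \<delta>})"
        using H2 x v \<epsilon>(2) by simp
    qed (use \<epsilon>(2) in auto)
    show "\<bar>hv x v - c x\<bar> \<le> \<eta>" using v by (intro close x) auto
  qed (use that in auto)

  \<comment> \<open>The full integrand of the nonlinear operator at the fixed point; it measures the consistency error.\<close>
  define b where "b x y = k1 x y * fstar x + k2 x y * H fstar x" for x y
  have b_cont: "continuous_on ({-1..1} \<times> {-1..1}) (\<lambda>(x, y). b x y)"
    using continuous_on_add[OF mult_kernel[OF k1 fstar] mult_kernel[OF k2 H_cont[OF fstar]]]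
    by (simp add: b_def case_prod_beta)
  have fstar_eq: "fstar y = integral {-1..1} (\<lambda>x. b x y) + g y" if y: "y \<in> {-1..1}" for y
  proof -
    have "fstar y = integral {-1..1} (\<lambda>x. k1 x y * fstar x) + integral {-1..1} (\<lambda>x. k2 x y * H fstar x) + g y"
      using fun_cong[OF fixpoint, of y] y by (simp add: G_op_def H_def)
    also have "integral {-1..1} (\<lambda>x. k1 x y * fstar x) + integral {-1..1} (\<lambda>x. k2 x y * H fstar x)
        = integral {-1..1} (\<lambda>x. b x y)"
      unfolding b_def by (intro integral_add[symmetric] integrable_continuous_interval continuous_intros
          k1_sect(2) k2_sect(2) y fstar H_cont)
    finally show ?thesis .
  qed
  have "0 < \<epsilon> / (2 * C)" using \<epsilon> C by simp
  from gauss_quad_tendsto_integral_uniformly[OF b_cont this]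
  obtain m1 where consistent: "\<And>m y. m \<ge> m1 \<Longrightarrow> y \<in> {-1..1} \<Longrightarrow>
      \<bar>gauss_quad m (\<lambda>x. b x y) - integral {-1..1} (\<lambda>x. b x y)\<bar> < \<epsilon> / (2 * C)"
    unfolding eventually_sequentially by blast

  have "\<exists>!f. f \<in> mcball_of C0 fstar \<epsilon> \<and> Gm_op k1 k2 h g m f = f" if m: "m \<ge> max m0 m1" for m
  proof -
    have m_m0: "m \<ge> m0" and m_m1: "m \<ge> m1" and m_1: "m \<ge> 1" using m m0 by auto
    note stable = stable[OF m_m0]
    define K where "K \<phi> y = gauss_quad m (\<lambda>t. a t y * \<phi> t)" for \<phi> y
    define G where "G f y = gauss_quad m (\<lambda>t. k1 t y * f t + k2 t y * H f t) + g y" for f y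
    have K_diff: "K \<phi> y - K \<psi> y = K (\<lambda>t. \<phi> t - \<psi> t) y" for \<phi> \<psi> y
      unfolding K_def gauss_quad_diff[symmetric] by (simp add: right_diff_distrib)
    have Gm: "Gm_op k1 k2 h g m f = restrict (G f) {-1..1}" for f
      by (simp add: Gm_op_def G_def gauss_quad_def H_def distrib_left sum.distrib mult.assoc fun_eq_iff)
    have G_cont: "continuous_on {-1..1} (G f)" if "continuous_on {-1..1} f" for f
      unfolding G_def
      by (intro continuous_intros continuous_on_gauss_quad m_1 k1_sect(1) k2_sect(1) G1)
    have K_cont: "continuous_on {-1..1} (K \<phi>)" for \<phi>
      unfolding K_def by (intro continuous_intros continuous_on_gauss_quad m_1 a_sect(1))
    have solvable: "\<exists>\<phi>. \<phi> \<in> mspace C0 \<and> (\<forall>y\<in>{-1..1}. \<phi> y - K \<phi> y = r y)" if r: "continuous_on {-1..1} r" for r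
    proof -
      obtain \<phi> where \<phi>: "continuous_on {-1..1} \<phi>" "\<And>y. y \<in> {-1..1} \<Longrightarrow> \<phi> y - K \<phi> y = r y"
      proof (rule gauss_quad_equation_solvable[OF m_1 a_sect(1) r])
        fix \<phi> assume \<phi>: "continuous_on {-1..1} \<phi>"
          and "\<And>y. y \<in> {-1..1} \<Longrightarrow> \<phi> y = gauss_quad m (\<lambda>t. a t y * \<phi> t)"
        then have "\<bar>\<phi> y\<bar> \<le> C * 0" if "y \<in> {-1..1}" for y
          using that by (intro stable[OF \<phi>]) auto
        then show "\<forall>y\<in>{-1..1}. \<phi> y = 0" by simp
      qed (auto simp: K_def)
      have "K (restrict \<phi> {-1..1}) y = K \<phi> y" for y
        unfolding K_def gauss_quad_def using gauss_nodes_subset[OF m_1]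
        by (intro sum.cong refl) (simp add: subset_eq)
      then show ?thesis using \<phi>
        by (intro exI[of _ "restrict \<phi> {-1..1}"]) (simp add: restrict_mem_C0)
    qed
    \<comment> \<open>The map \<open>T f = (I - K)\<^sup>-\<^sup>1 (G f - K f)\<close>, which on \<open>C\<^sup>0\<close> has the fixed points of \<open>G\<close>.\<close>
    have "\<forall>f. \<exists>\<phi>. f \<in> mspace C0 \<longrightarrow> \<phi> \<in> mspace C0 \<and> (\<forall>y\<in>{-1..1}. \<phi> y - K \<phi> y = G f y - K f y)"
      using solvable[OF continuous_on_diff[OF G_cont K_cont]] by (auto simp: mem_C0_iff)
    then obtain T where T_C0: "\<And>f. f \<in> mspace C0 \<Longrightarrow> T f \<in> mspace C0"
      and T_eq: "\<And>f y. f \<in> mspace C0 \<Longrightarrow> y \<in> {-1..1} \<Longrightarrow> T f y - K (T f) y = G f y - K f y"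
      by metis
    have T_fix: "T f = f \<longleftrightarrow> Gm_op k1 k2 h g m f = f" if f: "f \<in> mspace C0" for f
    proof
      assume "T f = f"
      then have "G f y = f y" if "y \<in> {-1..1}" for y using T_eq[OF f that] by simp
      then show "Gm_op k1 k2 h g m f = f"
        using f by (auto simp: Gm mem_C0_iff extensional_def fun_eq_iff restrict_def)
    next
      assume fixp: "Gm_op k1 k2 h g m f = f"
      have Gf: "G f y = f y" if "y \<in> {-1..1}" for y
        using fun_cong[OF fixp, of y] that by (simp add: Gm)
      have cont: "continuous_on {-1..1} (\<lambda>y. T f y - f y)"
        using f T_C0[OF f] by (intro continuous_intros) (auto simp: mem_C0_iff)
      have "\<bar>(T f y - f y) - gauss_quad m (\<lambda>t. a t y * (T f t - f t))\<bar> \<le> 0" if y: "y \<in> {-1..1}" for y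
        using T_eq[OF f y] Gf[OF y] K_diff[of "T f" y f] by (simp add: K_def)
      from stable[OF cont this] have "T f y = f y" if "y \<in> {-1..1}" for y
        using that by force
      then show "T f = f"
        using T_C0[OF f] f by (intro extensionalityI[of _ "{-1..1}"]) (auto simp: mem_C0_iff)
    qed
    have T_contr: "mdist C0 (T f) (T f') \<le> 1 / 2 * mdist C0 f f'"
      if ff': "f \<in> mcball_of C0 fstar \<epsilon>" "f' \<in> mcball_of C0 fstar \<epsilon>" for f f'
    proof -
      have f: "f \<in> mspace C0" and f': "f' \<in> mspace C0" using ff' by auto
      let ?d = "mdist C0 f f'"
      have near: "\<bar>f t - fstar t\<bar> \<le> \<epsilon>" "\<bar>f' t - fstar t\<bar> \<le> \<epsilon>" if "t \<in> {-1..1}" for t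
        using abs_diff_le_mdist_C0[OF fstar_C0 f that] abs_diff_le_mdist_C0[OF fstar_C0 f' that] ff'
        by (simp_all add: abs_minus_commute del: atLeastAtMost_iff)
      have residual: "\<bar>(T f y - T f' y) - gauss_quad m (\<lambda>t. a t y * (T f t - T f' t))\<bar> \<le> 2 * (B * (\<eta> * ?d))"
        if y: "y \<in> {-1..1}" for y
      proof -
        have "(T f y - T f' y) - gauss_quad m (\<lambda>t. a t y * (T f t - T f' t)) = (G f y - G f' y) - K (\<lambda>t. f t - f' t) y"
          using T_eq[OF f y] T_eq[OF f' y] K_diff[of "T f" y "T f'"] K_diff[of f y f'] by (simp add: K_def)
        also have "\<dots> = gauss_quad m (\<lambda>t. k2 t y * (h t (f t) - h t (f' t) - c t * (f t - f' t)))"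
          unfolding G_def K_def a_def H_def gauss_quad_def
          by (simp add: algebra_simps sum_subtractf sum.distrib)
        also have "\<bar>\<dots>\<bar> \<le> 2 * (B * (\<eta> * ?d))"
        proof (intro gauss_quad_bound m_1)
          fix t :: real assume t: "t \<in> {-1..1}"
          have "\<bar>h t (f t) - h t (f' t) - c t * (f t - f' t)\<bar> \<le> \<eta> * \<bar>f t - f' t\<bar>"
            using near[OF t] by (intro h_lin t)
          also have "\<dots> \<le> \<eta> * ?d"
            using abs_diff_le_mdist_C0[OF f f' t] \<eta> by (intro mult_left_mono) auto
          finally show "\<bar>k2 t y * (h t (f t) - h t (f' t) - c t * (f t - f' t))\<bar> \<le> B * (\<eta> * ?d)"
            unfolding abs_mult using B(2)[OF t y] B(1) by (intro mult_mono) auto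
        qed
        finally show ?thesis .
      qed
      have "continuous_on {-1..1} (\<lambda>y. T f y - T f' y)"
        using T_C0[OF f] T_C0[OF f'] by (intro continuous_intros) (auto simp: mem_C0_iff)
      from stable[OF this residual]
      have "mdist C0 (T f) (T f') \<le> C * (2 * (B * (\<eta> * ?d)))"
        unfolding mdist_C0_le_iff[OF T_C0[OF f] T_C0[OF f']] by blast
      also have "\<dots> = 1 / 2 * ?d" using B(1) C by (simp add: \<eta>_def field_simps)
      finally show ?thesis .
    qed
    have T_start: "mdist C0 fstar (T fstar) \<le> (1 - 1 / 2) * \<epsilon>"
    proof -
      have residual: "\<bar>(fstar y - T fstar y) - gauss_quad m (\<lambda>t. a t y * (fstar t - T fstar t))\<bar> \<le> \<epsilon> / (2 * C)"
        if y: "y \<in> {-1..1}" for y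
      proof -
        have "(fstar y - T fstar y) - gauss_quad m (\<lambda>t. a t y * (fstar t - T fstar t)) = fstar y - G fstar y"
          using T_eq[OF fstar_C0 y] K_diff[of fstar y "T fstar"] by (simp add: K_def)
        also have "\<dots> = integral {-1..1} (\<lambda>x. b x y) - gauss_quad m (\<lambda>x. b x y)"
          using fstar_eq[OF y] by (simp add: G_def b_def)
        also have "\<bar>\<dots>\<bar> \<le> \<epsilon> / (2 * C)"
          using consistent[OF m_m1 y] by linarith
        finally show ?thesis .
      qed
      have "continuous_on {-1..1} (\<lambda>y. fstar y - T fstar y)"
        using T_C0[OF fstar_C0] fstar by (intro continuous_intros) (auto simp: mem_C0_iff)
      from stable[OF this residual]
      have "mdist C0 fstar (T fstar) \<le> C * (\<epsilon> / (2 * C))"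
        unfolding mdist_C0_le_iff[OF fstar_C0 T_C0[OF fstar_C0]] by blast
      then show ?thesis using C by simp
    qed
    have "\<exists>!f. f \<in> mcball_of C0 fstar \<epsilon> \<and> T f = f"
      by (rule contraction_fixpoint_mcball_of[OF mcomplete_of_C0 fstar_C0, where q = "1 / 2"])
         (use T_C0 T_contr T_start in auto)
    moreover have "f \<in> mcball_of C0 fstar \<epsilon> \<and> T f = f \<longleftrightarrow>
        f \<in> mcball_of C0 fstar \<epsilon> \<and> Gm_op k1 k2 h g m f = f" for f
      using T_fix by auto
    ultimately show ?thesis by simp
  qed
  then show ?thesis using \<epsilon> by blast
qed

end
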